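(* Let $n$ be a positive integer, let $\mathbf{A}$ be an infinite $n$-generated subdirectly irreducible bi-Heyting algebra validating $LFC$, let $\mathfrak{X}=\mathbf{A}_*$ with greatest element $r$, and let $m$ be a minimal element of $\mathfrak{X}$ with $X=\{x:m<x\}\uplus min(\mathfrak{X})$ and such that every minimal $y\ne m$ has a unique immediate successor lying strictly above $m$. Write $\Downarrow x$ for the set of immediate predecessors of $x$, and $\uparrow m=\{x: m\le x\}$. Then: (i) if $x$ is an up limit, then $2\le|\Downarrow x|\le 2^n$; (ii) $\mathfrak{X}$ has no down limits; (iii) $\uparrow m$ is an infinite well-order; (iv) if $x$ is an immediate successor of $m$, then $|\Downarrow x|\le 2$; (v) if $m<x$, $x$ is not an immediate successor of $m$ and $x$ is not an up limit, then $x$ has exactly one immediate predecessor $z$ with $m<z$ and exactly one immediate predecessor $z$ with $m\not<z$.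
   Context: Bi-Heyting algebras are bounded distributive lattices with residuated $\to$ and $\leftarrow$. $\mathbf{A}_*$ is the bi-Esakia dual of $\mathbf{A}$: prime filters ordered by inclusion with the Priestley topology. For SI $\mathbf{A}$ validating $\mathsf{bi\text{-}LC}$ (bi-intuitionistic logic plus $(p\to q)\vee(q\to p)$), $\mathbf{A}_*$ is a bi-Esakia co-tree: it has a greatest element and principal upsets are chains. $LFC=\mathsf{bi\text{-}LC}+\beta(\mathfrak{F}_0)+\mathcal{J}(\mathfrak{F}_1)+\mathcal{J}(\mathfrak{F}_2)+\mathcal{J}(\mathfrak{F}_3)$. For a finite co-tree $\mathfrak{Y}$: - $\mathfrak{X}\not\models\beta(\mathfrak{Y})$ iff $\mathfrak{Y}$ order-embeds into $\mathfrak{X}$; - $\mathfrak{X}\not\models\mathcal{J}(\mathfrak{Y})$ iff there is a continuous surjective bi-p-morphism onto $\mathfrak{Y}$. The co-trees are: - $\mathfrak{F}_0$: $d<b<a$, $e<c<a$; - $\mathfrak{F}_1$: the chain $c<b<a$; - $\mathfrak{F}_2$: the chain $d<c<b<a$ plus $a'<a$, with $a'$ incomparable to $b,c,d$; - $\mathfrak{F}_3$: a top over three incomparable minimal points. A point $x$ with $m<x$ is an up limit if $x$ has no immediate predecessor in $\uparrow m$. A point $x\in\uparrow m\setminus\{r\}$ is a down limit if $x$ has no immediate successor. *)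

theory Defs
  imports "HOL-Analysis.Analysis"
begin

definition bi_heyting ::
  "('a::{distrib_lattice,bounded_lattice} \<Rightarrow> 'a \<Rightarrow> 'a) \<Rightarrow> ('a \<Rightarrow> 'a \<Rightarrow> 'a) \<Rightarrow> bool" where
  "bi_heyting imp coimp \<longleftrightarrow>
     (\<forall>a b c. c \<le> imp a b \<longleftrightarrow> inf c a \<le> b) \<and>
     (\<forall>a b c. coimp a b \<le> c \<longleftrightarrow> a \<le> sup b c)"

definition bh_congruence ::
  "('a::{distrib_lattice,bounded_lattice} \<Rightarrow> 'a \<Rightarrow> 'a) \<Rightarrow> ('a \<Rightarrow> 'a \<Rightarrow> 'a) \<Rightarrow> 'a rel \<Rightarrow> bool" where
  "bh_congruence imp coimp \<theta> \<longleftrightarrow> equiv UNIV \<theta> \<and>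
     (\<forall>a b c d. (a, b) \<in> \<theta> \<longrightarrow> (c, d) \<in> \<theta> \<longrightarrow>
        (inf a c, inf b d) \<in> \<theta> \<and> (sup a c, sup b d) \<in> \<theta> \<and>
        (imp a c, imp b d) \<in> \<theta> \<and> (coimp a c, coimp b d) \<in> \<theta>)"

definition bh_SI ::
  "('a::{distrib_lattice,bounded_lattice} \<Rightarrow> 'a \<Rightarrow> 'a) \<Rightarrow> ('a \<Rightarrow> 'a \<Rightarrow> 'a) \<Rightarrow> bool" where
  "bh_SI imp coimp \<longleftrightarrow>
     (\<exists>\<mu>. bh_congruence imp coimp \<mu> \<and> \<mu> \<noteq> Id \<and>
          (\<forall>\<theta>. bh_congruence imp coimp \<theta> \<and> \<theta> \<noteq> Id \<longrightarrow> \<mu> \<subseteq> \<theta>))"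

inductive_set bh_generated ::
  "('a::{distrib_lattice,bounded_lattice} \<Rightarrow> 'a \<Rightarrow> 'a) \<Rightarrow> ('a \<Rightarrow> 'a \<Rightarrow> 'a) \<Rightarrow> 'a set \<Rightarrow> 'a set"
  for imp coimp G where
  gen: "a \<in> G \<Longrightarrow> a \<in> bh_generated imp coimp G"
| bot: "bot \<in> bh_generated imp coimp G"
| top: "top \<in> bh_generated imp coimp G"
| inf: "a \<in> bh_generated imp coimp G \<Longrightarrow> b \<in> bh_generated imp coimp G \<Longrightarrow> inf a b \<in> bh_generated imp coimp G"
| sup: "a \<in> bh_generated imp coimp G \<Longrightarrow> b \<in> bh_generated imp coimp G \<Longrightarrow> sup a b \<in> bh_generated imp coimp G"
| imp: "a \<in> bh_generated imp coimp G \<Longrightarrow> b \<in> bh_generated imp coimp G \<Longrightarrow> imp a b \<in> bh_generated imp coimp G"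
| coimp: "a \<in> bh_generated imp coimp G \<Longrightarrow> b \<in> bh_generated imp coimp G \<Longrightarrow> coimp a b \<in> bh_generated imp coimp G"

definition n_generated ::
  "nat \<Rightarrow> ('a::{distrib_lattice,bounded_lattice} \<Rightarrow> 'a \<Rightarrow> 'a) \<Rightarrow> ('a \<Rightarrow> 'a \<Rightarrow> 'a) \<Rightarrow> bool" where
  "n_generated n imp coimp \<longleftrightarrow>
     (\<exists>G. finite G \<and> card G \<le> n \<and> bh_generated imp coimp G = UNIV)"

definition prime_filter :: "'a::{distrib_lattice,bounded_lattice} set \<Rightarrow> bool" where
  "prime_filter P \<longleftrightarrow> top \<in> P \<and> bot \<notin> P \<and>
     (\<forall>a b. a \<in> P \<longrightarrow> a \<le> b \<longrightarrow> b \<in> P) \<and>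
     (\<forall>a b. a \<in> P \<longrightarrow> b \<in> P \<longrightarrow> inf a b \<in> P) \<and>
     (\<forall>a b. sup a b \<in> P \<longrightarrow> a \<in> P \<or> b \<in> P)"

text \<open>Points of A_*: prime filters, ordered by inclusion.\<close>
definition dual_pts :: "'a::{distrib_lattice,bounded_lattice} set set" where
  "dual_pts = {P. prime_filter P}"

definition stone_map :: "'a::{distrib_lattice,bounded_lattice} \<Rightarrow> 'a set set" where
  "stone_map a = {P \<in> dual_pts. a \<in> P}"

definition priestley_top :: "'a::{distrib_lattice,bounded_lattice} set topology" where
  "priestley_top = topology_generated_by
     (range stone_map \<union> (\<lambda>a. dual_pts - stone_map a) ` UNIV)"

definition order_embeds ::
  "'b set \<Rightarrow> ('b \<Rightarrow> 'b \<Rightarrow> bool) \<Rightarrow> 'c set \<Rightarrow> ('c \<Rightarrow> 'c \<Rightarrow> bool) \<Rightarrow> bool" where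
  "order_embeds Y leY X leX \<longleftrightarrow>
     (\<exists>f. f ` Y \<subseteq> X \<and> inj_on f Y \<and> (\<forall>y\<in>Y. \<forall>y'\<in>Y. leX (f y) (f y') \<longleftrightarrow> leY y y'))"

definition bi_p_morphism ::
  "('c \<Rightarrow> 'b) \<Rightarrow> 'c set \<Rightarrow> ('c \<Rightarrow> 'c \<Rightarrow> bool) \<Rightarrow> 'b set \<Rightarrow> ('b \<Rightarrow> 'b \<Rightarrow> bool) \<Rightarrow> bool" where
  "bi_p_morphism f X leX Y leY \<longleftrightarrow>
     f ` X \<subseteq> Y \<and>
     (\<forall>x\<in>X. \<forall>x'\<in>X. leX x x' \<longrightarrow> leY (f x) (f x')) \<and>
     (\<forall>x\<in>X. \<forall>y\<in>Y. leY (f x) y \<longrightarrow> (\<exists>x'\<in>X. leX x x' \<and> f x' = y)) \<and>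
     (\<forall>x\<in>X. \<forall>y\<in>Y. leY y (f x) \<longrightarrow> (\<exists>x'\<in>X. leX x' x \<and> f x' = y))"

definition maps_onto ::
  "('a::{distrib_lattice,bounded_lattice} itself) \<Rightarrow> nat set \<Rightarrow> (nat \<Rightarrow> nat \<Rightarrow> bool) \<Rightarrow> bool" where
  "maps_onto TYPE('a) Y leY \<longleftrightarrow>
     (\<exists>f :: 'a set \<Rightarrow> nat.
        continuous_map (priestley_top :: 'a set topology) (discrete_topology Y) f \<and>
        f ` (dual_pts :: 'a set set) = Y \<and>
        bi_p_morphism f dual_pts (\<subseteq>) Y leY)"

text \<open>F0: a=0, b=1, c=2, d=3, e=4 with d<b<a, e<c<a.\<close>
definition F0 :: "nat set" where "F0 = {0,1,2,3,4}"
definition leF0 :: "nat \<Rightarrow> nat \<Rightarrow> bool" where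
  "leF0 x y \<longleftrightarrow> x = y \<or> (x, y) \<in> {(1,0),(3,1),(3,0),(2,0),(4,2),(4,0)}"

text \<open>F1: the chain c<b<a with a=0, b=1, c=2.\<close>
definition F1 :: "nat set" where "F1 = {0,1,2}"
definition leF1 :: "nat \<Rightarrow> nat \<Rightarrow> bool" where "leF1 x y \<longleftrightarrow> y \<le> x"

text \<open>F2: chain d<c<b<a (a=0,b=1,c=2,d=3) plus a'=4 with a'<a only.\<close>
definition F2 :: "nat set" where "F2 = {0,1,2,3,4}"
definition leF2 :: "nat \<Rightarrow> nat \<Rightarrow> bool" where
  "leF2 x y \<longleftrightarrow> x = y \<or> (x \<le> 3 \<and> y \<le> x) \<or> (x = 4 \<and> y = 0)"

definition F3 :: "nat set" where "F3 = {0,1,2,3}"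
definition leF3 :: "nat \<Rightarrow> nat \<Rightarrow> bool" where "leF3 x y \<longleftrightarrow> x = y \<or> y = 0"

definition validates_biLC ::
  "('a::{distrib_lattice,bounded_lattice} \<Rightarrow> 'a \<Rightarrow> 'a) \<Rightarrow> bool" where
  "validates_biLC imp \<longleftrightarrow> (\<forall>a b. sup (imp a b) (imp b a) = top)"

text \<open>A validates beta(F0) iff F0 does not order-embed into A_*; A validates J(F) iff
  there is no continuous surjective bi-p-morphism from A_* onto F.\<close>
definition validates_LFC ::
  "('a::{distrib_lattice,bounded_lattice} \<Rightarrow> 'a \<Rightarrow> 'a) \<Rightarrow> ('a \<Rightarrow> 'a \<Rightarrow> 'a) \<Rightarrow> bool" where
  "validates_LFC imp coimp \<longleftrightarrow>
     validates_biLC imp \<and>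
     \<not> order_embeds F0 leF0 (dual_pts :: 'a set set) (\<subseteq>) \<and>
     \<not> maps_onto TYPE('a) F1 leF1 \<and>
     \<not> maps_onto TYPE('a) F2 leF2 \<and>
     \<not> maps_onto TYPE('a) F3 leF3"

definition imm_pred :: "'a::{distrib_lattice,bounded_lattice} set \<Rightarrow> 'a set \<Rightarrow> bool" where
  "imm_pred z x \<longleftrightarrow> z \<in> dual_pts \<and> x \<in> dual_pts \<and> z \<subset> x \<and>
     \<not> (\<exists>w\<in>dual_pts. z \<subset> w \<and> w \<subset> x)"

definition imm_preds :: "'a::{distrib_lattice,bounded_lattice} set \<Rightarrow> 'a set set" where
  "imm_preds x = {z. imm_pred z x}"

definition minimals :: "'a::{distrib_lattice,bounded_lattice} set set" where
  "minimals = {x \<in> dual_pts. \<not> (\<exists>y\<in>dual_pts. y \<subset> x)}"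

definition up_set :: "'a::{distrib_lattice,bounded_lattice} set \<Rightarrow> 'a set set" where
  "up_set m = {x \<in> dual_pts. m \<subseteq> x}"

definition up_limit :: "'a::{distrib_lattice,bounded_lattice} set \<Rightarrow> 'a set \<Rightarrow> bool" where
  "up_limit m x \<longleftrightarrow> x \<in> dual_pts \<and> m \<subset> x \<and> \<not> (\<exists>z\<in>up_set m. imm_pred z x)"

definition down_limit :: "'a::{distrib_lattice,bounded_lattice} set \<Rightarrow> 'a set \<Rightarrow> 'a set \<Rightarrow> bool" where
  "down_limit m r x \<longleftrightarrow> x \<in> up_set m - {r} \<and> \<not> (\<exists>y. imm_pred x y)"

end

theory Submission
  imports Defs
begin

text \<open>
  The space is a comb: a chain \<open>up_set m\<close>, the spine, with minimal points hanging from it. The forbidden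
  images \<open>F1\<close>, \<open>F2\<close>, \<open>F3\<close> force exactly one minimal point to hang from each spine point that has an
  immediate predecessor above \<open>m\<close>. Colour each point by the generators it contains. A bisimulation
  for \<open>\<subseteq>\<close> and \<open>\<supseteq>\<close> that preserves colours is trivial, because the elements it does not distinguish form a
  subalgebra containing the generators. Near a down limit, compactness makes the spine constant in
  colour and lets every colour of a hanging point recur at the limit, so a whole segment could be
  collapsed: there are no down limits, and the spine is well ordered. At an up limit the minimal
  points hanging below converge to one hanging at the limit; were it the only one, a segment could again
  be collapsed. Equally coloured points hanging from the same spine point could be identified, which bounds
  their number.
\<close>

section \<open>Prime filters and the bi-Heyting operations\<close>

text \<open>Two kinds of quotient occur, and topology separates them. A map onto a finite co-tree
  must be continuous, so each fibre has to be cut out by finitely many elements of the algebra. At a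
  gap \<open>z \<subset> x\<close> of the spine this is possible: the points above \<open>x\<close>
  and the points not below \<open>z\<close> form clopen sets. At a limit there is no gap, and the
  quotient is given only by a bisimulation. This relation need not be closed, since triviality is
  proved by induction over terms in the generators. Limits of hanging points (teeth) are under
  control because minimality is a closed condition: it says that no element
  \<open>inf a (coimp top a)\<close> belongs to the point. The bound \<open>2 ^ n\<close> counts
  colours, that is, subsets of a generating set with at most \<open>n\<close> elements. The point
  \<open>m\<close> needs its own argument as a possible down limit: points lying below smaller and
  smaller spine points converge there to \<open>m\<close> itself, not to a tooth, so the whole
  downset of a spine point is merged instead.\<close>

lemma prime_filter_separates:
  fixes F I :: "'a::{distrib_lattice,bounded_lattice} set"
  assumes F: "F \<noteq> {}" "\<And>a b. a \<in> F \<Longrightarrow> a \<le> b \<Longrightarrow> b \<in> F" "\<And>a b. a \<in> F \<Longrightarrow> b \<in> F \<Longrightarrow> inf a b \<in> F"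
    and I: "I \<noteq> {}" "\<And>a b. a \<in> I \<Longrightarrow> b \<le> a \<Longrightarrow> b \<in> I" "\<And>a b. a \<in> I \<Longrightarrow> b \<in> I \<Longrightarrow> sup a b \<in> I"
    and disj: "F \<inter> I = {}"
  shows "\<exists>P\<in>dual_pts. F \<subseteq> P \<and> P \<inter> I = {}"
proof -
  define \<A> where "\<A> = {H. F \<subseteq> H \<and> H \<inter> I = {} \<and> (\<forall>a\<in>H. \<forall>b. a \<le> b \<longrightarrow> b \<in> H) \<and> (\<forall>a\<in>H. \<forall>b\<in>H. inf a b \<in> H)}"
  have "F \<in> \<A>"
    using F disj unfolding \<A>_def by blast
  have "\<exists>M\<in>\<A>. \<forall>H\<in>\<A>. M \<subseteq> H \<longrightarrow> H = M"
  proof (rule subset_Zorn_nonempty)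
    show "\<A> \<noteq> {}" using \<open>F \<in> \<A>\<close> by blast
    fix \<C> assume ne: "\<C> \<noteq> {}" and ch: "subset.chain \<A> \<C>"
    have sub: "\<C> \<subseteq> \<A>" and lin: "\<And>H K. H \<in> \<C> \<Longrightarrow> K \<in> \<C> \<Longrightarrow> H \<subseteq> K \<or> K \<subseteq> H"
      using ch unfolding subset_chain_def by auto
    have "inf a b \<in> \<Union>\<C>" if "a \<in> \<Union>\<C>" "b \<in> \<Union>\<C>" for a b
    proof -
      obtain H K where HK: "H \<in> \<C>" "a \<in> H" "K \<in> \<C>" "b \<in> K" using \<open>a \<in> \<Union>\<C>\<close> \<open>b \<in> \<Union>\<C>\<close> by blast
      obtain L where "L \<in> \<C>" "a \<in> L" "b \<in> L" using lin[OF HK(1,3)] HK by blast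
      then show ?thesis using sub unfolding \<A>_def by blast
    qed
    moreover have member: "F \<subseteq> H" "H \<inter> I = {}" "\<forall>a\<in>H. \<forall>b. a \<le> b \<longrightarrow> b \<in> H" if "H \<in> \<C>" for H
      using that sub unfolding \<A>_def by auto
    moreover have "F \<subseteq> \<Union>\<C>" "\<Union>\<C> \<inter> I = {}" "\<forall>a\<in>\<Union>\<C>. \<forall>b. a \<le> b \<longrightarrow> b \<in> \<Union>\<C>"
      using ne member by blast+
    ultimately show "\<Union>\<C> \<in> \<A>" unfolding \<A>_def by simp
  qed
  then obtain P where P: "P \<in> \<A>" and maxP: "\<And>H. H \<in> \<A> \<Longrightarrow> P \<subseteq> H \<Longrightarrow> H = P" by blast
  have P_sub: "F \<subseteq> P" and P_I: "P \<inter> I = {}" and P_up: "\<And>a b. a \<in> P \<Longrightarrow> a \<le> b \<Longrightarrow> b \<in> P"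
    and P_inf: "\<And>a b. a \<in> P \<Longrightarrow> b \<in> P \<Longrightarrow> inf a b \<in> P"
    using P unfolding \<A>_def by auto
  \<comment> \<open>By maximality the filter generated by \<open>P\<close> and \<open>a\<close>
    meets \<open>I\<close>. Primeness follows: if both disjuncts were outside \<open>P\<close>,
    distributivity would put a join of two elements of \<open>I\<close> into
    \<open>P\<close>.\<close>
  have adjoin: "\<exists>d\<in>P. \<exists>i\<in>I. inf d a \<le> i" if "a \<notin> P" for a
  proof (rule ccontr)
    assume no: "\<not> ?thesis"
    define H where "H = {c. \<exists>d\<in>P. inf d a \<le> c}"
    have "P \<subseteq> H" unfolding H_def by (auto intro: inf_le1)
    moreover have "H \<in> \<A>"
    proof -
      have "inf b c \<in> H" if bc: "b \<in> H" "c \<in> H" for b c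
      proof -
        obtain d e where "d \<in> P" "inf d a \<le> b" "e \<in> P" "inf e a \<le> c"
          using bc unfolding H_def by blast
        moreover from this have "inf (inf d e) a \<le> inf b c"
          by (meson inf.boundedI inf_le1 inf_le2 inf_mono order.trans order_refl)
        ultimately show ?thesis using P_inf unfolding H_def by blast
      qed
      moreover have "H \<inter> I = {}" using no I(2) unfolding H_def by blast
      ultimately show ?thesis
        using \<open>P \<subseteq> H\<close> P_sub order_trans unfolding \<A>_def H_def by blast
    qed
    moreover have "a \<in> H" using F(1) P_sub unfolding H_def by auto
    ultimately show False using maxP that by blast
  qed
  have "a \<in> P \<or> b \<in> P" if ab: "sup a b \<in> P" for a b
  proof (rule ccontr)
    assume "\<not> ?thesis"
    then obtain d i e j where *: "d \<in> P" "i \<in> I" "inf d a \<le> i" "e \<in> P" "j \<in> I" "inf e b \<le> j"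
      using adjoin by meson
    have "inf (inf d e) (sup a b) = sup (inf (inf d e) a) (inf (inf d e) b)"
      by (rule inf_sup_distrib1)
    also have "\<dots> \<le> sup i j"
      by (rule sup_mono; meson * inf_le1 inf_le2 inf_mono order.trans order_refl)
    finally have "sup i j \<in> P" using P_up P_inf * ab by blast
    then show False using I(3) * P_I by blast
  qed
  moreover have "top \<in> P" using F(1) P_sub P_up top_greatest by blast
  moreover have "bot \<notin> P" using I(1,2) P_I bot_least by blast
  ultimately have "P \<in> dual_pts"
    using P_up P_inf unfolding dual_pts_def prime_filter_def by blast
  then show ?thesis using P_sub P_I by blast
qed

lemma dual_ptsD:
  assumes "P \<in> dual_pts"
  shows dual_top: "top \<in> P" and dual_bot: "bot \<notin> P"
    and dual_up: "a \<in> P \<Longrightarrow> a \<le> b \<Longrightarrow> b \<in> P"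
    and dual_inf: "inf a b \<in> P \<longleftrightarrow> a \<in> P \<and> b \<in> P"
    and dual_sup: "sup a b \<in> P \<longleftrightarrow> a \<in> P \<or> b \<in> P"
proof -
  have P: "prime_filter P" using assms unfolding dual_pts_def by simp
  then show "top \<in> P" "bot \<notin> P" and up: "\<And>a b. a \<in> P \<Longrightarrow> a \<le> b \<Longrightarrow> b \<in> P"
    unfolding prime_filter_def by blast+
  show "inf a b \<in> P \<longleftrightarrow> a \<in> P \<and> b \<in> P"
    using P up inf_le1 inf_le2 unfolding prime_filter_def by metis
  show "sup a b \<in> P \<longleftrightarrow> a \<in> P \<or> b \<in> P"
    using P up sup_ge1 sup_ge2 unfolding prime_filter_def by metis
qed

lemma stone_map_inj:
  assumes "stone_map a = stone_map b"
  shows "a = b"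
proof -
  have le: "a \<le> b" if "stone_map a = stone_map b" for a b :: 'a
  proof (rule ccontr)
    assume "\<not> a \<le> b"
    then have "\<exists>P\<in>dual_pts. {a..} \<subseteq> P \<and> P \<inter> {..b} = {}"
      by (intro prime_filter_separates) (auto intro: order_trans)
    then show False using that unfolding stone_map_def by auto
  qed
  show ?thesis using le[OF assms] le[OF assms[symmetric]] by simp
qed

lemma infinite_dual_pts:
  assumes "infinite (UNIV :: 'a::{distrib_lattice,bounded_lattice} set)"
  shows "infinite (dual_pts :: 'a set set)"
proof
  assume "finite (dual_pts :: 'a set set)"
  moreover have "range stone_map \<subseteq> Pow (dual_pts :: 'a set set)"
    unfolding stone_map_def by blast
  ultimately have "finite (range (stone_map :: 'a \<Rightarrow> _))"
    using finite_subset by blast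
  then show False
    using assms stone_map_inj finite_imageD by (metis injI)
qed

text \<open>The points with a given membership pattern on a finite set form a clopen set, so such a
  map is locally constant. Continuity of each collapse below thus reduces to naming the finitely
  many elements that it reads.\<close>

lemma continuous_map_discrete_if_finitely_determined:
  fixes f :: "'a::{distrib_lattice,bounded_lattice} set \<Rightarrow> 'b"
  assumes "finite G"
    and det: "\<And>P Q. P \<in> dual_pts \<Longrightarrow> Q \<in> dual_pts \<Longrightarrow> P \<inter> G = Q \<inter> G \<Longrightarrow> f P = f Q"
    and Y: "f ` dual_pts \<subseteq> Y"
  shows "continuous_map priestley_top (discrete_topology Y) f"
proof -
  have top: "topspace (priestley_top :: 'a set topology) = dual_pts"
    unfolding priestley_top_def stone_map_def by (auto simp: dual_top)
  have basic: "openin priestley_top {Q \<in> dual_pts. Q \<inter> G = P \<inter> G}" for P :: "'a set"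
    using \<open>finite G\<close>
  proof (induction G)
    case empty
    then show ?case using openin_topspace[of "priestley_top :: 'a set topology"] by (simp add: top)
  next
    case (insert a G)
    have "openin priestley_top (stone_map a)" "openin priestley_top (dual_pts - stone_map a)"
      unfolding priestley_top_def by (auto intro!: topology_generated_by_Basis)
    then have "openin priestley_top {Q \<in> dual_pts. a \<in> Q \<longleftrightarrow> a \<in> P}"
      by (cases "a \<in> P") (auto simp: stone_map_def set_diff_eq Collect_conj_eq[symmetric] cong: conj_cong)
    then have "openin priestley_top ({Q \<in> dual_pts. a \<in> Q \<longleftrightarrow> a \<in> P} \<inter> {Q \<in> dual_pts. Q \<inter> G = P \<inter> G})"
      using insert.IH by blast
    moreover have "{Q \<in> dual_pts. a \<in> Q \<longleftrightarrow> a \<in> P} \<inter> {Q \<in> dual_pts. Q \<inter> G = P \<inter> G}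
        = {Q \<in> dual_pts. Q \<inter> insert a G = P \<inter> insert a G}"
      using \<open>a \<notin> G\<close> by blast
    ultimately show ?case by simp
  qed
  have "openin priestley_top {x \<in> dual_pts. f x \<in> U}" for U
  proof (subst openin_subopen, intro ballI)
    fix P assume P: "P \<in> {x \<in> dual_pts. f x \<in> U}"
    have "f Q \<in> U" if "Q \<in> dual_pts" "Q \<inter> G = P \<inter> G" for Q
      using det[of Q P] that P by simp
    then have "{Q \<in> dual_pts. Q \<inter> G = P \<inter> G} \<subseteq> {x \<in> dual_pts. f x \<in> U}"
      by blast
    then show "\<exists>T. openin priestley_top T \<and> P \<in> T \<and> T \<subseteq> {x \<in> dual_pts. f x \<in> U}"
      using basic[of P] P by blast
  qed
  then show ?thesis
    using Y unfolding continuous_map top by simp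
qed

text \<open>Compactness of the Priestley topology, read off from Tychonoff's theorem for the
  characteristic functions of the prime filters.\<close>

lemma dual_pts_cluster_point:
  fixes \<F> :: "'a::{distrib_lattice,bounded_lattice} set set set"
  assumes ne: "\<F> \<noteq> {}" "\<And>S. S \<in> \<F> \<Longrightarrow> S \<noteq> {} \<and> S \<subseteq> dual_pts"
    and lin: "\<And>S T. S \<in> \<F> \<Longrightarrow> T \<in> \<F> \<Longrightarrow> S \<subseteq> T \<or> T \<subseteq> S"
  shows "\<exists>P\<in>dual_pts. \<forall>S\<in>\<F>. \<forall>G. finite G \<longrightarrow> (\<exists>t\<in>S. t \<inter> G = P \<inter> G)"
proof -
  define X where "X = product_topology (\<lambda>_. discrete_topology (UNIV :: bool set)) (UNIV :: 'a set)"
  define ind where "ind = (\<lambda>(t :: 'a set) a. a \<in> t)"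
  define K where "K = (\<lambda>S. X closure_of (ind ` S))"
  have topX: "topspace X = UNIV" unfolding X_def by auto
  have "compact_space X"
    unfolding X_def compact_space_product_topology by (simp add: compact_space_discrete_topology)
  have fip: "\<Inter>\<G> \<noteq> {}" if "finite \<G>" "\<G> \<subseteq> K ` \<F>" for \<G>
  proof -
    obtain \<H> where \<H>: "finite \<H>" "\<H> \<subseteq> \<F>" "\<G> = K ` \<H>"
      using finite_subset_image[OF \<open>finite \<G>\<close> \<open>\<G> \<subseteq> K ` \<F>\<close>] by blast
    have "\<exists>S\<in>\<F>. \<forall>T\<in>\<H>. S \<subseteq> T" using \<H>(1,2)
    proof (induction \<H>)
      case empty then show ?case using ne(1) by blast
    next
      case (insert T \<H>)
      then obtain S where S: "S \<in> \<F>" "\<And>H. H \<in> \<H> \<Longrightarrow> S \<subseteq> H" by auto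
      have "T \<in> \<F>" using insert.prems by simp
      then consider "S \<subseteq> T" | "T \<subseteq> S" using lin S(1) by blast
      then show ?case
      proof cases
        case 1
        then show ?thesis using S by (intro bexI[of _ S]) auto
      next
        case 2
        have "T \<subseteq> H" if "H \<in> insert T \<H>" for H using that 2 S(2)[of H] by auto
        then show ?thesis using \<open>T \<in> \<F>\<close> by blast
      qed
    qed
    then obtain S where S: "S \<in> \<F>" "\<forall>T\<in>\<H>. S \<subseteq> T" by blast
    then obtain t where "t \<in> S" using ne(2) by blast
    then have "ind t \<in> K T" if "T \<in> \<H>" for T
      using S(2) that closure_of_subset[of "ind ` T" X] unfolding K_def topX by blast
    then show ?thesis using \<H>(3) by blast
  qed
  have "\<Inter> (K ` \<F>) \<noteq> {}"
    using \<open>compact_space X\<close> fip unfolding compact_space_fip K_def by (metis (no_types, lifting) closedin_closure_of imageE)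
  then obtain \<phi> where \<phi>: "\<And>S. S \<in> \<F> \<Longrightarrow> \<phi> \<in> K S" by blast
  define P where "P = Collect \<phi>"
  have near: "\<exists>t\<in>S. t \<inter> G = P \<inter> G" if "S \<in> \<F>" "finite G" for S G
  proof -
    define N where "N = (\<Pi>\<^sub>E a\<in>UNIV. if a \<in> G then {\<phi> a} else UNIV)"
    have "openin X N"
      unfolding X_def N_def
      by (rule product_topology_basis) (auto intro: finite_subset[OF _ \<open>finite G\<close>])
    moreover have "\<phi> \<in> N" unfolding N_def by auto
    ultimately obtain t where "t \<in> S" "ind t \<in> N"
      using \<phi>[OF \<open>S \<in> \<F>\<close>] unfolding K_def in_closure_of by blast
    then have "\<forall>a\<in>G. a \<in> t \<longleftrightarrow> a \<in> P"
      unfolding N_def ind_def P_def by (auto simp: PiE_iff split: if_splits)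
    then show ?thesis using \<open>t \<in> S\<close> by blast
  qed
  obtain S where S: "S \<in> \<F>" using ne(1) by blast
  \<comment> \<open>Each axiom of a prime filter involves at most three elements, and some genuine
    prime filter agrees with \<open>P\<close> on them.\<close>
  have agree: "\<exists>t\<in>dual_pts. \<forall>c\<in>H. c \<in> t \<longleftrightarrow> c \<in> P" if "finite H" for H
    using near[OF S that] ne(2)[OF S] by blast
  have "top \<in> P" using agree[of "{top}"] dual_top by auto
  moreover have "bot \<notin> P" using agree[of "{bot}"] dual_bot by auto
  moreover have "b \<in> P" if "a \<in> P" "a \<le> b" for a b
    using agree[of "{a, b}"] dual_up that by auto
  moreover have "inf a b \<in> P" if "a \<in> P" "b \<in> P" for a b
    using agree[of "{a, b, inf a b}"] dual_inf that by auto
  moreover have "a \<in> P \<or> b \<in> P" if "sup a b \<in> P" for a b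
    using agree[of "{a, b, sup a b}"] dual_sup that by auto
  ultimately have "P \<in> dual_pts" unfolding dual_pts_def prime_filter_def by blast
  then show ?thesis using near by blast
qed

text \<open>Linearity gives primeness: of two members refuting \<open>a\<close> and \<open>b\<close>
  separately, the smaller refutes both. For unions it gives closure under meets in the same
  way.\<close>

lemma dual_pts_Inter_chain:
  assumes "Q \<noteq> {}" "Q \<subseteq> dual_pts" and lin: "\<And>S T. S \<in> Q \<Longrightarrow> T \<in> Q \<Longrightarrow> S \<subseteq> T \<or> T \<subseteq> S"
  shows "\<Inter>Q \<in> dual_pts"
proof -
  have "a \<in> \<Inter>Q \<or> b \<in> \<Inter>Q" if "sup a b \<in> \<Inter>Q" for a b
  proof (rule ccontr)
    assume "\<not> ?thesis"
    then obtain S T where ST: "S \<in> Q" "a \<notin> S" "T \<in> Q" "b \<notin> T" by blast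
    then obtain R where "R \<in> Q" "a \<notin> R" "b \<notin> R" using lin[of S T] by blast
    then show False using that assms(2) dual_sup by blast
  qed
  moreover have "top \<in> \<Inter>Q" "bot \<notin> \<Inter>Q" "\<And>a b. a \<in> \<Inter>Q \<Longrightarrow> a \<le> b \<Longrightarrow> b \<in> \<Inter>Q"
    "\<And>a b. a \<in> \<Inter>Q \<Longrightarrow> b \<in> \<Inter>Q \<Longrightarrow> inf a b \<in> \<Inter>Q"
    using assms(1,2) by (auto dest: dual_top dual_bot dual_up dual_inf[THEN iffD2])
  ultimately show ?thesis
    unfolding dual_pts_def prime_filter_def by blast
qed

lemma dual_pts_Union_chain:
  assumes "Q \<noteq> {}" "Q \<subseteq> dual_pts" and lin: "\<And>S T. S \<in> Q \<Longrightarrow> T \<in> Q \<Longrightarrow> S \<subseteq> T \<or> T \<subseteq> S"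
  shows "\<Union>Q \<in> dual_pts"
proof -
  have "inf a b \<in> \<Union>Q" if ab: "a \<in> \<Union>Q" "b \<in> \<Union>Q" for a b
  proof -
    obtain S T where ST: "S \<in> Q" "a \<in> S" "T \<in> Q" "b \<in> T" using ab by blast
    then obtain R where "R \<in> Q" "a \<in> R" "b \<in> R" using lin[of S T] by blast
    then show ?thesis using assms(2) dual_inf by blast
  qed
  moreover have "top \<in> \<Union>Q" "bot \<notin> \<Union>Q" "\<And>a b. a \<in> \<Union>Q \<Longrightarrow> a \<le> b \<Longrightarrow> b \<in> \<Union>Q"
    "\<And>a b. sup a b \<in> \<Union>Q \<Longrightarrow> a \<in> \<Union>Q \<or> b \<in> \<Union>Q"
    using assms(1,2) dual_top dual_bot dual_up dual_sup by (blast | fast)+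
  ultimately show ?thesis
    unfolding dual_pts_def prime_filter_def by blast
qed

section \<open>Membership of implications and co-implications in prime filters; minimal points;
  bisimulations\<close>

locale bi_heyting_algebra =
  fixes imp coimp :: "'a::{distrib_lattice,bounded_lattice} \<Rightarrow> 'a \<Rightarrow> 'a"
  assumes bi_heyting: "bi_heyting imp coimp"
begin

lemma le_imp_iff: "c \<le> imp a b \<longleftrightarrow> inf c a \<le> b"
  and coimp_le_iff: "coimp a b \<le> c \<longleftrightarrow> a \<le> sup b c"
  using bi_heyting by (simp_all add: bi_heyting_def)

text \<open>If \<open>imp a b\<close> is not in \<open>x\<close>, residuation keeps \<open>b\<close>
  out of the filter generated by \<open>x\<close> and \<open>a\<close>, and this filter extends to a
  prime filter without \<open>b\<close>.\<close>

lemma imp_mem_iff: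
  assumes x: "x \<in> dual_pts"
  shows "imp a b \<in> x \<longleftrightarrow> (\<forall>y\<in>dual_pts. x \<subseteq> y \<longrightarrow> a \<in> y \<longrightarrow> b \<in> y)"
proof
  assume "imp a b \<in> x"
  moreover have "inf (imp a b) a \<le> b" using le_imp_iff by blast
  ultimately show "\<forall>y\<in>dual_pts. x \<subseteq> y \<longrightarrow> a \<in> y \<longrightarrow> b \<in> y"
    by (meson dual_inf dual_up in_mono)
next
  assume R: "\<forall>y\<in>dual_pts. x \<subseteq> y \<longrightarrow> a \<in> y \<longrightarrow> b \<in> y"
  show "imp a b \<in> x"
  proof (rule ccontr)
    assume not: "imp a b \<notin> x"
    define F where "F = {c. \<exists>d\<in>x. inf d a \<le> c}"
    have inf_F: "inf c d \<in> F" if cd: "c \<in> F" "d \<in> F" for c d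
    proof -
      obtain p q where "p \<in> x" "inf p a \<le> c" "q \<in> x" "inf q a \<le> d"
        using cd unfolding F_def by blast
      moreover from this have "inf (inf p q) a \<le> inf c d"
        by (meson inf.boundedI inf_le1 inf_le2 inf_mono order.trans order_refl)
      ultimately show ?thesis using x dual_inf unfolding F_def by blast
    qed
    have "top \<in> F" "a \<in> F" "x \<subseteq> F"
      using dual_top[OF x] unfolding F_def by (auto intro: inf_le1)
    moreover have "b \<notin> F"
      using not le_imp_iff dual_up[OF x] unfolding F_def by blast
    ultimately have "\<exists>P\<in>dual_pts. F \<subseteq> P \<and> P \<inter> {..b} = {}"
      using inf_F by (intro prime_filter_separates) (auto simp: F_def intro: order_trans)
    then show False using R \<open>a \<in> F\<close> \<open>x \<subseteq> F\<close> by blast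
  qed
qed

text \<open>Dual argument with the ideal generated by \<open>b\<close> and the complement of
  \<open>x\<close>: a prime filter missing this ideal lies below \<open>x\<close>.\<close>

lemma coimp_mem_iff:
  assumes x: "x \<in> dual_pts"
  shows "coimp a b \<in> x \<longleftrightarrow> (\<exists>y\<in>dual_pts. y \<subseteq> x \<and> a \<in> y \<and> b \<notin> y)"
proof
  assume "\<exists>y\<in>dual_pts. y \<subseteq> x \<and> a \<in> y \<and> b \<notin> y"
  then obtain y where y: "y \<in> dual_pts" "y \<subseteq> x" "a \<in> y" "b \<notin> y" by blast
  have "a \<le> sup b (coimp a b)" using coimp_le_iff by blast
  then show "coimp a b \<in> x" using y dual_sup dual_up by blast
next
  assume in_x: "coimp a b \<in> x"
  define I where "I = {c. \<exists>d. d \<notin> x \<and> c \<le> sup b d}"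
  have sup_I: "sup c d \<in> I" if cd: "c \<in> I" "d \<in> I" for c d
  proof -
    obtain p q where "p \<notin> x" "c \<le> sup b p" "q \<notin> x" "d \<le> sup b q"
      using cd unfolding I_def by blast
    moreover from this have "sup c d \<le> sup b (sup p q)"
      by (meson sup.boundedI sup_ge1 sup_ge2 sup_mono order.trans order_refl)
    ultimately show ?thesis using x dual_sup unfolding I_def by blast
  qed
  have "b \<in> I" and compl: "- x \<subseteq> I"
    using dual_bot[OF x] unfolding I_def by (auto intro: sup_ge2)
  moreover have "a \<notin> I"
    using in_x coimp_le_iff dual_up[OF x] unfolding I_def by blast
  ultimately have "\<exists>P\<in>dual_pts. {a..} \<subseteq> P \<and> P \<inter> I = {}"
    using sup_I by (intro prime_filter_separates) (auto simp: I_def intro: order_trans)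
  then show "\<exists>y\<in>dual_pts. y \<subseteq> x \<and> a \<in> y \<and> b \<notin> y"
    using \<open>b \<in> I\<close> compl by blast
qed

text \<open>The element \<open>inf a (coimp top a)\<close> belongs to \<open>y\<close> exactly when
  \<open>a\<close> is in \<open>y\<close> but missing from some point below it. The minimal points
  are therefore an intersection of clopen sets, and limits of minimal points stay minimal.\<close>

lemma minimals_iff:
  "y \<in> minimals \<longleftrightarrow> y \<in> dual_pts \<and> (\<forall>a. inf a (coimp top a) \<notin> y)"
proof -
  have "(\<exists>a. inf a (coimp top a) \<in> y) \<longleftrightarrow> (\<exists>z\<in>dual_pts. z \<subset> y)" if y: "y \<in> dual_pts"
  proof -
    have "inf a (coimp top a) \<in> y \<longleftrightarrow> a \<in> y \<and> (\<exists>z\<in>dual_pts. z \<subseteq> y \<and> a \<notin> z)" for a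
      using dual_top by (auto simp: dual_inf[OF y] coimp_mem_iff[OF y])
    then show ?thesis by (simp add: psubset_eq) blast
  qed
  then show ?thesis unfolding minimals_def by blast
qed

text \<open>In a comb such a \<open>u\<close> serves as a guard: put into a meet or used as an
  antecedent, it restricts a condition to spine points strictly above \<open>m\<close>.\<close>

lemma nonminimal_witness:
  fixes x :: "'a set"
  assumes "x \<in> dual_pts" "x \<notin> minimals"
  obtains u where "u \<in> x" "\<And>y. y \<in> minimals \<Longrightarrow> u \<notin> y"
proof -
  obtain a where "inf a (coimp top a) \<in> x" using assms minimals_iff by blast
  then show thesis using that minimals_iff by blast
qed

text \<open>Symmetry is built in, so the forward and backward conditions need to be stated on one
  side only. No topological condition is imposed.\<close>

definition bisimulation :: "'a set \<Rightarrow> ('a set \<Rightarrow> 'a set \<Rightarrow> bool) \<Rightarrow> bool" where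
  "bisimulation G R \<longleftrightarrow> (\<forall>x\<in>dual_pts. \<forall>y\<in>dual_pts. R x y \<longrightarrow>
     R y x \<and> x \<inter> G = y \<inter> G \<and>
     (\<forall>u\<in>dual_pts. x \<subseteq> u \<longrightarrow> (\<exists>v\<in>dual_pts. y \<subseteq> v \<and> R u v)) \<and>
     (\<forall>u\<in>dual_pts. u \<subseteq> x \<longrightarrow> (\<exists>v\<in>dual_pts. v \<subseteq> y \<and> R u v)))"

lemma bisimulationD:
  assumes "bisimulation G R" "x \<in> dual_pts" "y \<in> dual_pts" "R x y"
  shows "R y x" "x \<inter> G = y \<inter> G"
    "\<And>u. u \<in> dual_pts \<Longrightarrow> x \<subseteq> u \<Longrightarrow> \<exists>v\<in>dual_pts. y \<subseteq> v \<and> R u v"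
    "\<And>u. u \<in> dual_pts \<Longrightarrow> u \<subseteq> x \<Longrightarrow> \<exists>v\<in>dual_pts. v \<subseteq> y \<and> R u v"
proof -
  note * = assms(1)[unfolded bisimulation_def, rule_format, OF assms(2-4)]
  show "R y x" using * by simp
  show "x \<inter> G = y \<inter> G" using * by simp
  show "\<exists>v\<in>dual_pts. y \<subseteq> v \<and> R u v" if "u \<in> dual_pts" "x \<subseteq> u" for u using * that by simp
  show "\<exists>v\<in>dual_pts. v \<subseteq> y \<and> R u v" if "u \<in> dual_pts" "u \<subseteq> x" for u using * that by simp
qed

text \<open>The elements that do not distinguish related points form a subalgebra containing the
  generators.\<close>

lemma bisimulation_trivial:
  assumes gen: "bh_generated imp coimp G = UNIV" and R: "bisimulation G R"
    and xy: "x \<in> dual_pts" "y \<in> dual_pts" "R x y"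
  shows "x = y"
proof -
  have "\<And>x y. x \<in> dual_pts \<Longrightarrow> y \<in> dual_pts \<Longrightarrow> R x y \<Longrightarrow> a \<in> x \<longleftrightarrow> a \<in> y"
    if "a \<in> bh_generated imp coimp G" for a
    using that
  proof induction
    case (gen a)
    then show ?case using bisimulationD(2)[OF R gen.prems] by auto
  next
    case (imp a b)
    have "imp a b \<in> y" if xy: "x \<in> dual_pts" "y \<in> dual_pts" "R x y" and "imp a b \<in> x" for x y
    proof -
      have "b \<in> v" if v: "v \<in> dual_pts" "y \<subseteq> v" "a \<in> v" for v
      proof -
        obtain u where "u \<in> dual_pts" "x \<subseteq> u" "R v u"
          using bisimulationD(3)[OF R xy(2,1) bisimulationD(1)[OF R xy] v(1,2)] by blast
        then show ?thesis
          using imp.IH v \<open>imp a b \<in> x\<close> imp_mem_iff[OF xy(1)] by blast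
      qed
      then show ?thesis using imp_mem_iff[OF xy(2)] by blast
    qed
    then show ?case using imp.prems bisimulationD(1)[OF R] by metis
  next
    case (coimp a b)
    have "coimp a b \<in> y" if xy: "x \<in> dual_pts" "y \<in> dual_pts" "R x y" and "coimp a b \<in> x" for x y
    proof -
      obtain u where u: "u \<in> dual_pts" "u \<subseteq> x" "a \<in> u" "b \<notin> u"
        using \<open>coimp a b \<in> x\<close> coimp_mem_iff[OF xy(1)] by blast
      then obtain v where "v \<in> dual_pts" "v \<subseteq> y" "R u v"
        using bisimulationD(4)[OF R xy] by blast
      then show ?thesis using coimp.IH u coimp_mem_iff[OF xy(2)] by blast
    qed
    then show ?case using coimp.prems bisimulationD(1)[OF R] by metis
  qed (auto simp: dual_top dual_bot dual_inf dual_sup)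
  then show ?thesis using gen xy by blast
qed

end

section \<open>Combs: a chain with further minimal points hanging below it\<close>

locale comb = bi_heyting_algebra imp coimp
  for imp coimp :: "'a::{distrib_lattice,bounded_lattice} \<Rightarrow> 'a \<Rightarrow> 'a" +
  fixes m r :: "'a set"
  assumes biLC: "validates_biLC imp"
    and r_pt: "r \<in> dual_pts" and le_r: "x \<in> dual_pts \<Longrightarrow> x \<subseteq> r"
    and m_min: "m \<in> minimals"
    and spine_or_minimal: "x \<in> dual_pts \<Longrightarrow> m \<subset> x \<or> x \<in> minimals"
begin

lemma m_pt: "m \<in> dual_pts"
  using m_min unfolding minimals_def by blast

lemma minimal_pt: "t \<in> minimals \<Longrightarrow> t \<in> dual_pts"
  unfolding minimals_def by blast

lemma minimal_eq: "t \<in> minimals \<Longrightarrow> y \<in> dual_pts \<Longrightarrow> y \<subseteq> t \<Longrightarrow> y = t"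
  unfolding minimals_def by blast

lemma spine_not_minimal: "m \<subset> x \<Longrightarrow> x \<notin> minimals"
  using m_pt unfolding minimals_def by blast

lemma above_minimal: "t \<in> minimals \<Longrightarrow> g \<in> dual_pts \<Longrightarrow> t \<subset> g \<Longrightarrow> m \<subset> g"
  using spine_or_minimal[of g] minimal_eq[of g t] minimal_pt[of t] by auto

text \<open>For incomparable \<open>c\<close> and \<open>d\<close> with witnesses \<open>a\<close>
  and \<open>b\<close>, prelinearity puts \<open>imp a b\<close> or \<open>imp b a\<close> into
  \<open>y\<close>; the first fails at \<open>c\<close>, the second at \<open>d\<close>.\<close>

lemma upper_chain:
  fixes y :: "'a set"
  assumes y: "y \<in> dual_pts" and c: "c \<in> dual_pts" "y \<subseteq> c" and d: "d \<in> dual_pts" "y \<subseteq> d"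
  shows "c \<subseteq> d \<or> d \<subseteq> c"
proof (rule ccontr)
  assume "\<not> ?thesis"
  then obtain a b where ab: "a \<in> c" "a \<notin> d" "b \<in> d" "b \<notin> c" by blast
  have "sup (imp a b) (imp b a) \<in> y"
    using biLC dual_top[OF y] unfolding validates_biLC_def by simp
  then have "imp a b \<in> y \<or> imp b a \<in> y" using dual_sup[OF y] by simp
  then show False using imp_mem_iff[OF y] c d ab by blast
qed

lemma spine_chain: "c \<in> dual_pts \<Longrightarrow> d \<in> dual_pts \<Longrightarrow> m \<subseteq> c \<Longrightarrow> m \<subseteq> d \<Longrightarrow> c \<subseteq> d \<or> d \<subseteq> c"
  using upper_chain[OF m_pt] by blast

lemma imm_predD:
  assumes "imm_pred z x"
  shows "z \<in> dual_pts" "x \<in> dual_pts" "z \<subset> x" "w \<in> dual_pts \<Longrightarrow> z \<subset> w \<Longrightarrow> \<not> w \<subset> x"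
  using assms unfolding imm_pred_def by auto

lemma imm_pred_above:
  fixes z :: "'a set"
  assumes "imm_pred z x" "w \<in> dual_pts" "z \<subset> w"
  shows "x \<subseteq> w"
proof -
  have "x \<subseteq> w \<or> w \<subseteq> x"
    using upper_chain[of z x w] imm_predD(1,2,3)[OF assms(1)] assms(2,3) by auto
  then show ?thesis using imm_predD(4)[OF assms] by blast
qed

text \<open>Every point strictly above a minimal point lies on the spine, so only spine points can
  come between.\<close>

lemma tooth_imm_predI:
  assumes "x \<in> dual_pts" "m \<subset> x" "P \<in> minimals" "P \<subseteq> x"
    and "\<And>q. q \<in> dual_pts \<Longrightarrow> m \<subset> q \<Longrightarrow> q \<subset> x \<Longrightarrow> \<not> P \<subseteq> q"
  shows "imm_pred P x"
proof -
  have "P \<subset> x" using assms(2-4) spine_not_minimal by blast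
  moreover have "\<not> w \<subset> x" if "w \<in> dual_pts" "P \<subset> w" for w
    using assms(5)[OF that(1) above_minimal[OF assms(3) that]] that(2) by blast
  ultimately show ?thesis
    using assms(1) minimal_pt[OF assms(3)] unfolding imm_pred_def by blast
qed

text \<open>A point \<open>q\<close> of the spine strictly below \<open>x\<close> lies in a clopen set whose downset avoids
  all minimal points that hang from the spine at or above \<open>x\<close>; this is why a limit of such
  minimal points hangs exactly at \<open>x\<close>.\<close>

lemma limit_of_teeth:
  fixes \<F> :: "'a set set set"
  assumes x: "x \<in> dual_pts" "m \<subset> x"
    and ne: "\<F> \<noteq> {}" and S: "\<And>S. S \<in> \<F> \<Longrightarrow> S \<noteq> {} \<and> S \<subseteq> minimals"
    and lin: "\<And>S T. S \<in> \<F> \<Longrightarrow> T \<in> \<F> \<Longrightarrow> S \<subseteq> T \<or> T \<subseteq> S"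
    and below: "\<And>a. a \<notin> x \<Longrightarrow> \<exists>S\<in>\<F>. \<forall>t\<in>S. a \<notin> t"
    and hang: "\<And>f. f \<in> x \<Longrightarrow> \<exists>S\<in>\<F>. \<forall>t\<in>S. \<forall>g\<in>dual_pts. m \<subset> g \<longrightarrow> t \<subseteq> g \<longrightarrow> f \<in> g"
  shows "\<exists>P\<in>minimals. imm_pred P x \<and> (\<forall>S\<in>\<F>. \<forall>G. finite G \<longrightarrow> (\<exists>t\<in>S. t \<inter> G = P \<inter> G))"
proof -
  have pts: "S \<noteq> {} \<and> S \<subseteq> dual_pts" if "S \<in> \<F>" for S
    using S[OF that] minimal_pt by blast
  obtain P where P: "P \<in> dual_pts" and near: "\<And>S G. S \<in> \<F> \<Longrightarrow> finite G \<Longrightarrow> \<exists>t\<in>S. t \<inter> G = P \<inter> G"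
    using dual_pts_cluster_point[OF ne pts lin] by blast
  have near1: "\<exists>t\<in>S. a \<in> t \<longleftrightarrow> a \<in> P" if "S \<in> \<F>" for S a
    using near[OF that, of "{a}"] by auto
  obtain S0 where S0: "S0 \<in> \<F>" using ne by blast
  have "inf a (coimp top a) \<notin> P" for a
  proof -
    obtain t where "t \<in> S0" "inf a (coimp top a) \<in> t \<longleftrightarrow> inf a (coimp top a) \<in> P"
      using near1[OF S0] by blast
    then show ?thesis using S[OF S0] minimals_iff by blast
  qed
  then have Pmin: "P \<in> minimals" using P minimals_iff by blast
  have "P \<subseteq> x"
  proof
    fix a assume "a \<in> P"
    show "a \<in> x"
    proof (rule ccontr)
      assume "a \<notin> x"
      then obtain S where "S \<in> \<F>" "\<forall>t\<in>S. a \<notin> t" using below[OF \<open>a \<notin> x\<close>] by blast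
      then show False using near1[of S a] \<open>a \<in> P\<close> by blast
    qed
  qed
  have "\<not> P \<subseteq> q" if q: "q \<in> dual_pts" "m \<subset> q" "q \<subset> x" for q
  proof
    assume "P \<subseteq> q"
    obtain e where e: "e \<in> q" "\<And>y. y \<in> minimals \<Longrightarrow> e \<notin> y"
      using nonminimal_witness[OF q(1) spine_not_minimal[OF q(2)]] by blast
    obtain f where f: "f \<in> x" "f \<notin> q" using q(3) by blast
    obtain S' where S': "S' \<in> \<F>" "\<forall>t\<in>S'. \<forall>g\<in>dual_pts. m \<subset> g \<longrightarrow> t \<subseteq> g \<longrightarrow> f \<in> g"
      using hang[OF f(1)] by blast
    \<comment> \<open>The clopen set consists of the points containing \<open>e\<close> but not
      \<open>f\<close>, and the complement of its downset is given by \<open>imp e f\<close>. The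
      guard \<open>e\<close> leaves only spine points above \<open>t\<close> to consider, and these
      contain \<open>f\<close>.\<close>
    have "imp e f \<in> t" if "t \<in> S'" for t
    proof -
      have t: "t \<in> dual_pts" using that pts[OF S'(1)] by blast
      have "f \<in> g" if g: "g \<in> dual_pts" "t \<subseteq> g" "e \<in> g" for g
      proof -
        have "m \<subset> g" using spine_or_minimal[OF g(1)] e(2) g(3) by blast
        then show ?thesis using S'(2) \<open>t \<in> S'\<close> g by blast
      qed
      then show ?thesis using imp_mem_iff[OF t] by blast
    qed
    then have "imp e f \<in> P" using near1[OF S'(1)] by blast
    then show False using imp_mem_iff[OF P] q(1) \<open>P \<subseteq> q\<close> e(1) f(2) by blast
  qed
  then have "imm_pred P x" using tooth_imm_predI[OF x Pmin \<open>P \<subseteq> x\<close>] by blast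
  then show ?thesis using Pmin near by blast
qed

text \<open>A gap in the spine is definable. An element of \<open>x\<close> missing from
  \<open>z\<close>, met with a guard, yields \<open>u\<close>. With a guard \<open>v\<close> for
  \<open>z\<close>, a point lacks \<open>imp v u\<close> when some spine point above it contains
  \<open>v\<close> but not \<open>u\<close>; such a spine point lies below \<open>z\<close>, and
  \<open>z\<close> is itself one.\<close>

lemma successor_witnesses:
  assumes zx: "imm_pred z x" and mz: "m \<subset> z"
  obtains u v where "\<And>q. q \<in> dual_pts \<Longrightarrow> u \<in> q \<longleftrightarrow> x \<subseteq> q"
    and "\<And>p. p \<in> dual_pts \<Longrightarrow> imp v u \<in> p \<longleftrightarrow> \<not> p \<subseteq> z"
    and "v \<in> z" and "\<And>y. y \<in> minimals \<Longrightarrow> v \<notin> y"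
    and "\<And>q. q \<in> dual_pts \<Longrightarrow> m \<subset> q \<Longrightarrow> x \<subseteq> q \<or> q \<subseteq> z"
proof -
  note z = imm_predD(1)[OF zx] and x = imm_predD(2)[OF zx] and less = imm_predD(3)[OF zx]
  have mx: "m \<subset> x" using mz less by blast
  have split: "x \<subseteq> q \<or> q \<subseteq> z" if "q \<in> dual_pts" "m \<subset> q" for q
    using spine_chain[of q z] imm_pred_above[OF zx, of q] that z mz by blast
  obtain v where v: "v \<in> z" "\<And>y. y \<in> minimals \<Longrightarrow> v \<notin> y"
    using nonminimal_witness[OF z spine_not_minimal[OF mz]] by blast
  obtain u1 where u1: "u1 \<in> x" "\<And>y. y \<in> minimals \<Longrightarrow> u1 \<notin> y"
    using nonminimal_witness[OF x spine_not_minimal[OF mx]] by blast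
  obtain u2 where u2: "u2 \<in> x" "u2 \<notin> z" using less by blast
  define u where "u = inf u1 u2"
  have u: "u \<in> q \<longleftrightarrow> x \<subseteq> q" if "q \<in> dual_pts" for q
  proof
    assume "u \<in> q"
    then have "u1 \<in> q" "u2 \<in> q" using dual_inf[OF that] unfolding u_def by blast+
    then show "x \<subseteq> q" using split[OF that] spine_or_minimal[OF that] u1 u2 by blast
  next
    assume "x \<subseteq> q"
    then show "u \<in> q" using dual_inf[OF that] u1(1) u2(1) unfolding u_def by blast
  qed
  have "imp v u \<in> p \<longleftrightarrow> \<not> p \<subseteq> z" if p: "p \<in> dual_pts" for p
  proof
    assume "imp v u \<in> p"
    then show "\<not> p \<subseteq> z" using imp_mem_iff[OF p] z v(1) u[OF z] less by blast
  next
    assume np: "\<not> p \<subseteq> z"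
    have "u \<in> w" if w: "w \<in> dual_pts" "p \<subseteq> w" "v \<in> w" for w
    proof -
      have "m \<subset> w" using spine_or_minimal[OF w(1)] v(2) w(3) by blast
      then show ?thesis using split[OF w(1)] np w u by blast
    qed
    then show "imp v u \<in> p" using imp_mem_iff[OF p] by blast
  qed
  then show thesis using that u v split by blast
qed

section \<open>Bi-p-morphisms onto the forbidden co-trees\<close>

lemma maps_ontoI:
  fixes f :: "'a set \<Rightarrow> nat"
  assumes "finite G" "\<And>P Q. P \<in> dual_pts \<Longrightarrow> Q \<in> dual_pts \<Longrightarrow> P \<inter> G = Q \<inter> G \<Longrightarrow> f P = f Q"
    and "f ` dual_pts = Y"
    and "\<And>p q. p \<in> dual_pts \<Longrightarrow> q \<in> dual_pts \<Longrightarrow> p \<subseteq> q \<Longrightarrow> le (f p) (f q)"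
    and "\<And>p y. p \<in> dual_pts \<Longrightarrow> y \<in> Y \<Longrightarrow> le (f p) y \<Longrightarrow> \<exists>q\<in>dual_pts. p \<subseteq> q \<and> f q = y"
    and "\<And>p y. p \<in> dual_pts \<Longrightarrow> y \<in> Y \<Longrightarrow> le y (f p) \<Longrightarrow> \<exists>q\<in>dual_pts. q \<subseteq> p \<and> f q = y"
  shows "maps_onto TYPE('a) Y le"
proof -
  have "continuous_map priestley_top (discrete_topology Y) f"
    using assms(1,2) by (rule continuous_map_discrete_if_finitely_determined) (use assms(3) in simp_all)
  moreover have "bi_p_morphism f dual_pts (\<subseteq>) Y le"
    unfolding bi_p_morphism_def using assms(3-6) by simp
  ultimately show ?thesis using assms(3) unfolding maps_onto_def by blast
qed

text \<open>The points containing \<open>u\<close> go to the top \<open>0\<close>. Below it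
  \<open>leF3\<close> is discrete, so monotonicity amounts to \<open>const\<close> and the downward
  condition to \<open>below\<close>; the upward condition holds because \<open>r\<close> is sent to
  \<open>0\<close>.\<close>

lemma maps_onto_F3I:
  fixes g :: "'a set \<Rightarrow> nat"
  assumes G: "finite G" "\<And>P Q. P \<in> dual_pts \<Longrightarrow> Q \<in> dual_pts \<Longrightarrow> P \<inter> G = Q \<inter> G \<Longrightarrow> g P = g Q"
    and u: "u \<in> r"
    and range: "\<And>p. p \<in> dual_pts \<Longrightarrow> g p \<in> {1, 2, 3}"
    and const: "\<And>p q. p \<in> dual_pts \<Longrightarrow> q \<in> dual_pts \<Longrightarrow> p \<subseteq> q \<Longrightarrow> u \<notin> q \<Longrightarrow> g p = g q"
    and below: "\<And>q k. q \<in> dual_pts \<Longrightarrow> u \<in> q \<Longrightarrow> k \<in> {1, 2, 3} \<Longrightarrow> \<exists>p\<in>dual_pts. p \<subseteq> q \<and> u \<notin> p \<and> g p = k"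
  shows "maps_onto TYPE('a) F3 leF3"
proof -
  define f where "f = (\<lambda>p. if u \<in> p then 0 else g p)"
  have f0: "f p = 0 \<longleftrightarrow> u \<in> p" if "p \<in> dual_pts" for p
    using range[OF that] unfolding f_def by auto
  have Y: "f ` dual_pts = F3"
  proof
    show "f ` dual_pts \<subseteq> F3" using range unfolding f_def F3_def by force
    have "0 \<in> f ` dual_pts" using f0[OF r_pt] u r_pt by (metis imageI)
    moreover have "k \<in> f ` dual_pts" if "k \<in> {1, 2, 3}" for k
      using below[OF r_pt u that] unfolding f_def by force
    ultimately show "F3 \<subseteq> f ` dual_pts" unfolding F3_def by auto
  qed
  show ?thesis
  proof (rule maps_ontoI[where G = "insert u G" and f = f])
    show "finite (insert u G)" using G(1) by simp
    show "f ` dual_pts = F3" by (rule Y)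
    show "f P = f Q" if "P \<in> dual_pts" "Q \<in> dual_pts" "P \<inter> insert u G = Q \<inter> insert u G" for P Q
    proof -
      have "P \<inter> G = Q \<inter> G" "u \<in> P \<longleftrightarrow> u \<in> Q" using that(3) by blast+
      then show ?thesis using G(2)[OF that(1,2)] unfolding f_def by simp
    qed
    show "leF3 (f p) (f q)" if "p \<in> dual_pts" "q \<in> dual_pts" "p \<subseteq> q" for p q
      using const[OF that] that(3) unfolding f_def leF3_def by auto
    show "\<exists>q\<in>dual_pts. p \<subseteq> q \<and> f q = y" if "p \<in> dual_pts" "y \<in> F3" "leF3 (f p) y" for p y
    proof (cases "y = 0")
      case True
      then show ?thesis using r_pt le_r[OF that(1)] f0[OF r_pt] u by blast
    next
      case False
      then show ?thesis using that unfolding leF3_def by blast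
    qed
    show "\<exists>q\<in>dual_pts. q \<subseteq> p \<and> f q = y" if p: "p \<in> dual_pts" "y \<in> F3" "leF3 y (f p)" for p y
    proof (cases "y = f p")
      case True
      then show ?thesis using that by blast
    next
      case False
      then have "f p = 0" "y \<in> {1, 2, 3}" using that unfolding leF3_def F3_def by auto
      then obtain q where "q \<in> dual_pts" "q \<subseteq> p" "u \<notin> q" "g q = y"
        using below[OF p(1), of y] f0[OF p(1)] by auto
      then show ?thesis unfolding f_def by auto
    qed
  qed
qed

text \<open>Every nonminimal point lies above the successor \<open>x\<close> of \<open>m\<close>, so
  all predecessors of \<open>x\<close> are minimal. Three of them lie below every nonminimal point,
  and splitting the minimal points into three clopen classes around them produces
  \<open>F3\<close>.\<close>

lemma card_imm_preds_bottom:
  assumes F3: "\<not> maps_onto TYPE('a) F3 leF3" and mx: "imm_pred m x"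
  shows "finite (imm_preds x) \<and> card (imm_preds x) \<le> 2"
proof (rule ccontr)
  assume "\<not> ?thesis"
  then obtain B where "B \<subseteq> imm_preds x" "card B = 3"
    by (metis not_less_eq_eq numeral_2_eq_2 numeral_3_eq_3 obtain_subset_with_card_n
        infinite_arbitrarily_large)
  then obtain y1 y2 y3 where y: "imm_pred y1 x" "imm_pred y2 x" "imm_pred y3 x"
    and ne: "y1 \<noteq> y2" "y1 \<noteq> y3" "y2 \<noteq> y3"
    unfolding card_3_iff imm_preds_def by auto
  note x = imm_predD(2)[OF mx]
  have min: "y \<in> minimals" if "imm_pred y x" for y
    using spine_or_minimal[of y] imm_predD[OF that] imm_predD(4)[OF mx, of y] by blast
  note y_min = y[THEN min]
  obtain u where u: "u \<in> x" "\<And>y. y \<in> minimals \<Longrightarrow> u \<notin> y"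
    using nonminimal_witness[OF x spine_not_minimal[OF imm_predD(3)[OF mx]]] by blast
  have u_iff: "u \<in> q \<longleftrightarrow> q \<notin> minimals" if "q \<in> dual_pts" for q
    using u spine_or_minimal[OF that] imm_pred_above[OF mx that] by blast
  have sep: "\<exists>a. a \<in> s \<and> a \<notin> t" if "s \<in> minimals" "t \<in> minimals" "s \<noteq> t" for s t
    using that minimal_eq[of t s] minimal_pt by blast
  obtain a1 where a1: "a1 \<in> y1" "a1 \<notin> y2" using sep y_min ne by blast
  obtain a2 where a2: "a2 \<in> y1" "a2 \<notin> y3" using sep y_min ne by blast
  obtain b where b: "b \<in> y2" "b \<notin> y3" using sep y_min ne by blast
  \<comment> \<open>A single element separating \<open>y1\<close> from both others. Since
    \<open>g\<close> tests \<open>a\<close> first, \<open>b\<close> only has to separate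
    \<open>y2\<close> from \<open>y3\<close>.\<close>
  define a where "a = inf a1 a2"
  have a: "a \<in> y1" "a \<notin> y2" "a \<notin> y3"
    using a1 a2 y_min[THEN minimal_pt] dual_inf unfolding a_def by blast+
  define g :: "'a set \<Rightarrow> nat" where "g = (\<lambda>p. if a \<in> p then 1 else if b \<in> p then 2 else 3)"
  have "maps_onto TYPE('a) F3 leF3"
  proof (rule maps_onto_F3I[where G = "{a, b}" and g = g and u = u])
    show "g P = g Q" if "P \<inter> {a, b} = Q \<inter> {a, b}" for P Q
    proof -
      have "a \<in> P \<longleftrightarrow> a \<in> Q" "b \<in> P \<longleftrightarrow> b \<in> Q" using that by blast+
      then show ?thesis unfolding g_def by simp
    qed
    show "u \<in> r" using le_r[OF x] u(1) by blast
    show "g p = g q" if "p \<in> dual_pts" "q \<in> dual_pts" "p \<subseteq> q" "u \<notin> q" for p q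
      using minimal_eq[of q p] u_iff[of q] that by blast
    show "\<exists>p\<in>dual_pts. p \<subseteq> q \<and> u \<notin> p \<and> g p = k" if "q \<in> dual_pts" "u \<in> q" "k \<in> {1, 2, 3}" for q k
    proof -
      have "x \<subseteq> q"
        using that(1,2) u_iff spine_or_minimal[OF that(1)] imm_pred_above[OF mx that(1)] by blast
      then have "y1 \<subseteq> q" "y2 \<subseteq> q" "y3 \<subseteq> q" using y[THEN imm_predD(3)] by blast+
      moreover have "g y1 = 1" "g y2 = 2" "g y3 = 3" using a b unfolding g_def by auto
      ultimately show ?thesis using that(3) y_min[THEN minimal_pt] y_min[THEN u(2)] by blast
    qed
  qed (auto simp: g_def)
  then show False using F3 by blast
qed

text \<open>The downset of \<open>z\<close> collapses to one minimal point. All other points not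
  above \<open>x\<close> are minimal, and an element \<open>b\<close> separating two teeth at
  \<open>x\<close> splits them into two clopen classes; the image is \<open>F3\<close>.\<close>

lemma successor_tooth_unique:
  assumes F3: "\<not> maps_onto TYPE('a) F3 leF3" and zx: "imm_pred z x" and mz: "m \<subset> z"
    and y: "imm_pred y1 x" "\<not> m \<subset> y1" "imm_pred y2 x" "\<not> m \<subset> y2"
  shows "y1 = y2"
proof (rule ccontr)
  assume ne: "y1 \<noteq> y2"
  note z = imm_predD(1)[OF zx] and x = imm_predD(2)[OF zx]
  obtain u v where u: "\<And>q. q \<in> dual_pts \<Longrightarrow> u \<in> q \<longleftrightarrow> x \<subseteq> q"
    and i: "\<And>p. p \<in> dual_pts \<Longrightarrow> imp v u \<in> p \<longleftrightarrow> \<not> p \<subseteq> z"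
    and "v \<in> z" and "\<And>y. y \<in> minimals \<Longrightarrow> v \<notin> y"
    and split: "\<And>q. q \<in> dual_pts \<Longrightarrow> m \<subset> q \<Longrightarrow> x \<subseteq> q \<or> q \<subseteq> z"
    by (rule successor_witnesses[OF zx mz]) (rule that)
  have y_min: "y1 \<in> minimals" "y2 \<in> minimals"
    using spine_or_minimal y imm_predD(1) by blast+
  then obtain b where b: "b \<in> y1" "b \<notin> y2"
    using ne minimal_eq[OF y_min(2), of y1] minimal_pt by blast
  have y_z: "\<not> y \<subseteq> z" if "imm_pred y x" "\<not> m \<subset> y" for y
    using that mz imm_predD(4)[OF that(1) z] imm_predD(3)[OF zx] by blast
  define g :: "'a set \<Rightarrow> nat" where "g = (\<lambda>p. if imp v u \<in> p then if b \<in> p then 2 else 3 else 1)"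
  have "maps_onto TYPE('a) F3 leF3"
  proof (rule maps_onto_F3I[where G = "{imp v u, b}" and g = g and u = u])
    show "g P = g Q" if "P \<inter> {imp v u, b} = Q \<inter> {imp v u, b}" for P Q
    proof -
      have "imp v u \<in> P \<longleftrightarrow> imp v u \<in> Q" "b \<in> P \<longleftrightarrow> b \<in> Q" using that by blast+
      then show ?thesis unfolding g_def by simp
    qed
    show "u \<in> r" using le_r[OF x] u[OF r_pt] by blast
    show "g p = g q" if pq: "p \<in> dual_pts" "q \<in> dual_pts" "p \<subseteq> q" "u \<notin> q" for p q
    proof (cases "q \<subseteq> z")
      case True
      then show ?thesis using i pq unfolding g_def by auto
    next
      case False
      then have "q \<in> minimals" using split[OF pq(2)] u[OF pq(2)] pq(4) spine_or_minimal[OF pq(2)] by blast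
      then show ?thesis using minimal_eq[of q p] pq by blast
    qed
    show "\<exists>p\<in>dual_pts. p \<subseteq> q \<and> u \<notin> p \<and> g p = k" if q: "q \<in> dual_pts" "u \<in> q" "k \<in> {1, 2, 3}" for q k
    proof -
      have "x \<subseteq> q" using u q by blast
      then have "y1 \<subseteq> q" "y2 \<subseteq> q" "z \<subseteq> q" using y zx imm_predD(3) by blast+
      moreover have "g y1 = 2" "g y2 = 3" "g z = 1"
        using b i z y_min[THEN minimal_pt] y_z y unfolding g_def by auto
      moreover have "u \<notin> y1" "u \<notin> y2" "u \<notin> z" using y zx imm_predD(1,3) u by blast+
      ultimately show ?thesis using q(3) z y_min[THEN minimal_pt] by blast
    qed
  qed (auto simp: g_def)
  then show False using F3 by blast
qed

text \<open>Without a minimal point at the successor \<open>x\<close> of \<open>z\<close>, the points of the spine from \<open>x\<close> up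
  to the next minimal point collapse to one. The result is the four-chain with the minimal points
  not below \<open>z\<close> hanging at the top, or a three-chain if there are none.\<close>

lemma successor_tooth_exists:
  assumes F1: "\<not> maps_onto TYPE('a) F1 leF1" and F2: "\<not> maps_onto TYPE('a) F2 leF2"
    and zx: "imm_pred z x" and mz: "m \<subset> z"
  shows "\<exists>t. imm_pred t x \<and> \<not> m \<subset> t"
proof (rule ccontr)
  assume no: "\<not> ?thesis"
  note z = imm_predD(1)[OF zx] and x = imm_predD(2)[OF zx] and less = imm_predD(3)[OF zx]
  obtain u v where u: "\<And>q. q \<in> dual_pts \<Longrightarrow> u \<in> q \<longleftrightarrow> x \<subseteq> q"
    and i: "\<And>p. p \<in> dual_pts \<Longrightarrow> imp v u \<in> p \<longleftrightarrow> \<not> p \<subseteq> z"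
    and v: "v \<in> z" "\<And>y. y \<in> minimals \<Longrightarrow> v \<notin> y"
    and split: "\<And>q. q \<in> dual_pts \<Longrightarrow> m \<subset> q \<Longrightarrow> x \<subseteq> q \<or> q \<subseteq> z"
    by (rule successor_witnesses[OF zx mz]) (rule that)
  have mx: "m \<subset> x" using mz less by blast
  \<comment> \<open>An exception would be minimal and, since the spine points below \<open>x\<close>
    are below \<open>z\<close>, would hang exactly at \<open>x\<close>.\<close>
  have below_x: "p \<subseteq> z" if p: "p \<in> dual_pts" "p \<subset> x" for p
  proof (rule ccontr)
    assume np: "\<not> p \<subseteq> z"
    then have min: "p \<in> minimals" using split[OF p(1)] spine_or_minimal[OF p(1)] p(2) by blast
    have "\<not> p \<subseteq> q" if "q \<in> dual_pts" "m \<subset> q" "q \<subset> x" for q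
      using split[OF that(1,2)] that(3) np by blast
    then have "imm_pred p x" using tooth_imm_predI[OF x mx min] p(2) by blast
    then show False using no spine_not_minimal[of p] min by blast
  qed
  have v_above: "m \<subseteq> q" if "q \<in> dual_pts" "v \<in> q" for q
    using spine_or_minimal[OF that(1)] v(2) that(2) by blast
  have facts: "\<not> x \<subseteq> z" "\<not> x \<subseteq> m" "m \<subseteq> z" "z \<subseteq> x" "m \<subseteq> x" "v \<notin> m" "x \<subseteq> r"
    using less mx mz v(2)[OF m_min] le_r[OF x] by blast+
  show False
  proof (cases "\<exists>t\<in>dual_pts. \<not> x \<subseteq> t \<and> \<not> t \<subseteq> z")
    case False
    then have dich: "x \<subseteq> p \<or> p \<subseteq> z" if "p \<in> dual_pts" for p using that by blast
    \<comment> \<open>The guard \<open>v\<close> cuts the downset of \<open>z\<close> in two. Spine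
      points below \<open>z\<close> may fall on the lower side; it suffices that \<open>z\<close>
      contains \<open>v\<close>, that \<open>m\<close> does not, and that every point containing
      \<open>v\<close> is above \<open>m\<close>.\<close>
    define f :: "'a set \<Rightarrow> nat" where "f = (\<lambda>p. if x \<subseteq> p then 0 else if v \<in> p then 1 else 2)"
    have vals: "f x = 0" "f z = 1" "f m = 2" using v facts unfolding f_def by auto
    have "maps_onto TYPE('a) F1 leF1"
    proof (rule maps_ontoI[where G = "{u, v}" and f = f])
      show "f P = f Q" if "P \<in> dual_pts" "Q \<in> dual_pts" "P \<inter> {u, v} = Q \<inter> {u, v}" for P Q
      proof -
        have "u \<in> P \<longleftrightarrow> u \<in> Q" "v \<in> P \<longleftrightarrow> v \<in> Q" using that by blast+
        then show ?thesis using u[OF that(1)] u[OF that(2)] unfolding f_def by simp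
      qed
      show "f ` dual_pts = F1"
      proof
        show "f ` dual_pts \<subseteq> F1" unfolding f_def F1_def by auto
        show "F1 \<subseteq> f ` dual_pts" using vals x z m_pt unfolding F1_def by (metis empty_subsetI imageI insert_subset)
      qed
      show "leF1 (f p) (f q)" if "p \<in> dual_pts" "q \<in> dual_pts" "p \<subseteq> q" for p q
        using that(3) unfolding f_def leF1_def by auto
      show "\<exists>q\<in>dual_pts. p \<subseteq> q \<and> f q = y" if p: "p \<in> dual_pts" "y \<in> F1" "leF1 (f p) y" for p y
      proof -
        consider "y = f p" | "y = 0" "\<not> x \<subseteq> p" | "y = 1" "\<not> x \<subseteq> p"
          using p unfolding F1_def leF1_def f_def by (auto split: if_splits)
        then show ?thesis
        proof cases
          case 1 then show ?thesis using p by blast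
        next
          case 2 then show ?thesis using dich[OF p(1)] facts x vals by blast
        next
          case 3 then show ?thesis using dich[OF p(1)] z vals by blast
        qed
      qed
      show "\<exists>q\<in>dual_pts. q \<subseteq> p \<and> f q = y" if p: "p \<in> dual_pts" "y \<in> F1" "leF1 y (f p)" for p y
      proof -
        consider "y = f p" | "y = 1" "x \<subseteq> p" | "y = 2" "x \<subseteq> p \<or> v \<in> p"
          using p unfolding F1_def leF1_def f_def by (auto split: if_splits)
        then show ?thesis
        proof cases
          case 1 then show ?thesis using p by blast
        next
          case 2 then show ?thesis using facts z vals by blast
        next
          case 3 then show ?thesis using facts v_above[OF p(1)] m_pt vals by blast
        qed
      qed
    qed simp
    then show False using F1 by blast
  next
    case True
    define T where "T = {t \<in> dual_pts. \<not> x \<subseteq> t \<and> \<not> t \<subseteq> z}"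
    have T_min: "t \<in> minimals" if "t \<in> T" for t
      using that split spine_or_minimal unfolding T_def by blast
    \<comment> \<open>\<open>T\<close> is cut out by \<open>imp v u\<close> without
      \<open>u\<close>, so this co-implication defines its upset: one element tells whether some
      point of \<open>T\<close> lies below.\<close>
    define w where "w = coimp (imp v u) u"
    have w: "w \<in> p \<longleftrightarrow> (\<exists>t\<in>T. t \<subseteq> p)" if "p \<in> dual_pts" for p
    proof -
      have T_iff: "y \<in> T \<longleftrightarrow> imp v u \<in> y \<and> u \<notin> y" if "y \<in> dual_pts" for y
        using u[OF that] i[OF that] that unfolding T_def by auto
      have "w \<in> p \<longleftrightarrow> (\<exists>y\<in>dual_pts. y \<subseteq> p \<and> y \<in> T)"
        unfolding w_def coimp_mem_iff[OF that] by (intro bex_cong refl) (simp add: T_iff)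
      then show ?thesis unfolding T_def by auto
    qed
    \<comment> \<open>The upset of \<open>x\<close> is divided into points above some element of
      \<open>T\<close> (value \<open>0\<close>) and the rest (value \<open>1\<close>). Value
      \<open>1\<close> is attained at \<open>x\<close> precisely because no tooth hangs
      there.\<close>
    define f :: "'a set \<Rightarrow> nat" where
      "f = (\<lambda>p. if x \<subseteq> p then if \<exists>t\<in>T. t \<subseteq> p then 0 else 1
                else if \<not> p \<subseteq> z then 4 else if v \<in> p then 2 else 3)"
    have no_T: "\<not> t \<subseteq> x" if "t \<in> T" for t
      using that below_x unfolding T_def by blast
    obtain t0 where t0: "t0 \<in> T" using True unfolding T_def by blast
    have "t0 \<subseteq> r" using le_r t0 unfolding T_def by blast
    then have vals: "f r = 0" "f x = 1" "f z = 2" "f m = 3" "\<And>t. t \<in> T \<Longrightarrow> f t = 4"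
      using v facts no_T t0 unfolding f_def T_def by auto
    have "maps_onto TYPE('a) F2 leF2"
    proof (rule maps_ontoI[where G = "{u, v, w, imp v u}" and f = f])
      show "f P = f Q" if "P \<in> dual_pts" "Q \<in> dual_pts"
        "P \<inter> {u, v, w, imp v u} = Q \<inter> {u, v, w, imp v u}" for P Q
      proof -
        have "u \<in> P \<longleftrightarrow> u \<in> Q" "v \<in> P \<longleftrightarrow> v \<in> Q" "w \<in> P \<longleftrightarrow> w \<in> Q" "imp v u \<in> P \<longleftrightarrow> imp v u \<in> Q"
          using that by blast+
        then show ?thesis
          using u[OF that(1)] u[OF that(2)] w[OF that(1)] w[OF that(2)] i[OF that(1)] i[OF that(2)]
          unfolding f_def by simp
      qed
      show "f ` dual_pts = F2"
      proof
        show "f ` dual_pts \<subseteq> F2" unfolding f_def F2_def by auto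
        have "t0 \<in> dual_pts" using t0 unfolding T_def by blast
        then show "F2 \<subseteq> f ` dual_pts" using vals(1-4) vals(5)[OF t0] x z m_pt r_pt
          unfolding F2_def by (metis empty_subsetI imageI insert_subset)
      qed
      show "leF2 (f p) (f q)" if pq: "p \<in> dual_pts" "q \<in> dual_pts" "p \<subseteq> q" for p q
      proof -
        have 1: "\<not> x \<subseteq> q \<Longrightarrow> \<not> q \<subseteq> z \<Longrightarrow> p = q" "\<not> x \<subseteq> p \<Longrightarrow> \<not> p \<subseteq> z \<Longrightarrow> \<exists>t\<in>T. t \<subseteq> q"
          using T_min[of q] minimal_eq[of q p] pq unfolding T_def by blast+
        have 2: "x \<subseteq> p \<Longrightarrow> x \<subseteq> q" "q \<subseteq> z \<Longrightarrow> p \<subseteq> z" "v \<in> p \<Longrightarrow> v \<in> q"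
          "\<exists>t\<in>T. t \<subseteq> p \<Longrightarrow> \<exists>t\<in>T. t \<subseteq> q" "x \<subseteq> p \<Longrightarrow> \<not> p \<subseteq> z"
          using pq(3) facts(1) by blast+
        show ?thesis
        proof (cases "x \<subseteq> q")
          case True
          then show ?thesis using 1 2
            by (cases "\<exists>t\<in>T. t \<subseteq> q"; cases "x \<subseteq> p") (simp_all add: f_def leF2_def, blast+)
        next
          case False
          then show ?thesis using 1 2
            by (cases "q \<subseteq> z"; cases "v \<in> q") (auto simp: f_def leF2_def)
        qed
      qed
      show "\<exists>q\<in>dual_pts. p \<subseteq> q \<and> f q = y" if p: "p \<in> dual_pts" "y \<in> F2" "leF2 (f p) y" for p y
      proof -
        consider "y = f p" | "y = 0" | "y = 1" "p \<subseteq> z" | "y = 2" "p \<subseteq> z"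
          using p unfolding F2_def leF2_def f_def by (auto split: if_splits)
        then show ?thesis
        proof cases
          case 1 then show ?thesis using p by blast
        next
          case 2 then show ?thesis using le_r[OF p(1)] r_pt vals by blast
        next
          case 3 then show ?thesis using facts x vals by blast
        next
          case 4 then show ?thesis using z vals by blast
        qed
      qed
      show "\<exists>q\<in>dual_pts. q \<subseteq> p \<and> f q = y" if p: "p \<in> dual_pts" "y \<in> F2" "leF2 y (f p)" for p y
      proof -
        consider "y = f p" | "y = 1" "x \<subseteq> p" | "y = 2" "x \<subseteq> p" | "y = 3" "x \<subseteq> p \<or> v \<in> p"
          | "y = 4" "\<exists>t\<in>T. t \<subseteq> p"
          using p unfolding F2_def leF2_def f_def by (auto split: if_splits)
        then show ?thesis
        proof cases
          case 1 then show ?thesis using p by blast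
        next
          case 2 then show ?thesis using x vals by blast
        next
          case 3 then show ?thesis using facts z vals by blast
        next
          case 4 then show ?thesis using facts v_above[OF p(1)] m_pt vals by blast
        next
          case 5 then show ?thesis using vals(5) T_def by blast
        qed
      qed
    qed simp
    then show False using F2 by blast
  qed
qed

end

section \<open>Finitely generated combs\<close>

text \<open>Used with finitely many generators: what they do at the union or intersection of a chain
  is already settled at one member.\<close>

lemma finite_subset_chain_member:
  assumes "finite H" "Q \<noteq> {}" and lin: "\<And>c d. c \<in> Q \<Longrightarrow> d \<in> Q \<Longrightarrow> c \<subseteq> d \<or> d \<subseteq> c"
  shows chain_contains: "H \<subseteq> \<Union>Q \<Longrightarrow> \<exists>c\<in>Q. H \<subseteq> c" and chain_avoids: "H \<inter> \<Inter>Q = {} \<Longrightarrow> \<exists>c\<in>Q. H \<inter> c = {}"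
proof -
  show "\<exists>c\<in>Q. H \<subseteq> c" if "H \<subseteq> \<Union>Q"
    using \<open>finite H\<close> that
  proof (induction H)
    case empty
    then show ?case using assms(2) by blast
  next
    case (insert g H)
    then obtain c d where "c \<in> Q" "H \<subseteq> c" "d \<in> Q" "g \<in> d" by auto
    moreover from this have "c \<subseteq> d \<or> d \<subseteq> c" using lin by blast
    ultimately show ?case by blast
  qed
  show "\<exists>c\<in>Q. H \<inter> c = {}" if "H \<inter> \<Inter>Q = {}"
    using \<open>finite H\<close> that
  proof (induction H)
    case empty
    then show ?case using assms(2) by blast
  next
    case (insert g H)
    then obtain c d where "c \<in> Q" "H \<inter> c = {}" "d \<in> Q" "g \<notin> d" by auto
    moreover from this have "c \<subseteq> d \<or> d \<subseteq> c" using lin by blast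
    ultimately show ?case by blast
  qed
qed

locale LFC_comb = comb imp coimp m r
  for imp coimp :: "'a::{distrib_lattice,bounded_lattice} \<Rightarrow> 'a \<Rightarrow> 'a" and m r +
  fixes G :: "'a set"
  assumes G: "finite G" "bh_generated imp coimp G = UNIV"
    and F1: "\<not> maps_onto TYPE('a) F1 leF1"
    and F2: "\<not> maps_onto TYPE('a) F2 leF2"
    and F3: "\<not> maps_onto TYPE('a) F3 leF3"
    and hanging: "t \<in> minimals \<Longrightarrow> t \<noteq> m \<Longrightarrow> \<exists>z. imm_pred t z \<and> m \<subset> z"
begin

text \<open>Two points have the same colour if they contain the same generators. A segment of the spine of
  constant colour cannot be collapsed together with equally coloured minimal points hanging from
  it, as the collapse would be a nontrivial bisimulation.\<close>

lemma no_collapse: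
  assumes ab: "a \<in> dual_pts" "b \<in> dual_pts" "m \<subset> a" "a \<subseteq> b"
    and colour: "\<And>c. c \<in> dual_pts \<Longrightarrow> a \<subseteq> c \<Longrightarrow> c \<subseteq> b \<Longrightarrow> c \<inter> G = a \<inter> G"
    and M: "M \<subseteq> minimals" "\<And>t. t \<in> M \<Longrightarrow> t \<subseteq> b"
      "\<And>t q. t \<in> M \<Longrightarrow> q \<in> dual_pts \<Longrightarrow> t \<subset> q \<Longrightarrow> a \<subseteq> q"
    and teeth: "\<And>e. e \<in> minimals \<Longrightarrow> e \<subseteq> b \<Longrightarrow> \<not> e \<subseteq> a \<Longrightarrow> e \<in> M \<and> (\<exists>p\<in>M. p \<subseteq> a \<and> p \<inter> G = e \<inter> G)"
  shows "a = b" and "\<And>s t. s \<in> M \<Longrightarrow> t \<in> M \<Longrightarrow> s \<inter> G = t \<inter> G \<Longrightarrow> s = t"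
proof -
  define I where "I = {c \<in> dual_pts. a \<subseteq> c \<and> c \<subseteq> b}"
  define R where "R = (\<lambda>c d. c = d \<or> c \<in> I \<and> d \<in> I \<or> c \<in> M \<and> d \<in> M \<and> c \<inter> G = d \<inter> G)"
  have R_refl: "R c c" for c unfolding R_def by simp
  have a_I: "a \<in> I" and b_I: "b \<in> I" using ab unfolding I_def by auto
  have spine: "c \<subseteq> d \<or> d \<subseteq> c" if "c \<in> dual_pts" "d \<in> dual_pts" "a \<subseteq> c" "a \<subseteq> d" for c d
    using spine_chain[OF that(1,2)] that(3,4) ab(3) by blast
  \<comment> \<open>An upward step to a point above \<open>a\<close> either stays in the segment,
    where \<open>b\<close> answers it, or passes beyond \<open>b\<close>, where the same point
    does.\<close>
  have up_I: "\<exists>v\<in>dual_pts. y \<subseteq> v \<and> R w v" if "y \<in> dual_pts" "y \<subseteq> b" "w \<in> dual_pts" "a \<subseteq> w" for y w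
  proof (cases "w \<subseteq> b")
    case True
    then show ?thesis using that ab(2) b_I unfolding R_def I_def by blast
  next
    case False
    then have "b \<subseteq> w" using spine[OF that(3) ab(2)] that(4) ab(4) by blast
    then show ?thesis using that R_refl by blast
  qed
  \<comment> \<open>A point below \<open>b\<close> but not below \<open>a\<close> is in the segment
    or is a tooth. The tooth is traded for an equally coloured one below \<open>a\<close>, hence
    below every point of the segment.\<close>
  have down_I: "\<exists>v\<in>dual_pts. v \<subseteq> y \<and> R w v" if y: "y \<in> I" and w: "w \<in> dual_pts" "w \<subseteq> b" for y w
  proof (cases "w \<subseteq> a")
    case True
    then show ?thesis using y w R_refl unfolding I_def by blast
  next
    case False
    show ?thesis
    proof (cases "w \<in> minimals")
      case True
      then obtain p where "p \<in> M" "p \<subseteq> a" "p \<inter> G = w \<inter> G" "w \<in> M"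
        using teeth[OF True w(2) False] by blast
      moreover from this have "p \<in> dual_pts" "R w p"
        using M(1) minimal_pt unfolding R_def by auto
      ultimately show ?thesis using y unfolding I_def by blast
    next
      case nonmin: False
      then have "m \<subset> w" using spine_or_minimal[OF w(1)] by blast
      then have "a \<subseteq> w" using spine_chain[OF w(1) ab(1)] ab(3) False by blast
      then show ?thesis using y w unfolding R_def I_def by blast
    qed
  qed
  have "bisimulation G R"
    unfolding bisimulation_def
  proof (intro ballI impI)
    fix x y assume xy: "x \<in> dual_pts" "y \<in> dual_pts" "R x y"
    then consider "x = y" | "x \<in> I" "y \<in> I" | "x \<in> M" "y \<in> M" "x \<inter> G = y \<inter> G"
      unfolding R_def by blast
    then show "R y x \<and> x \<inter> G = y \<inter> G \<and>
      (\<forall>u\<in>dual_pts. x \<subseteq> u \<longrightarrow> (\<exists>v\<in>dual_pts. y \<subseteq> v \<and> R u v)) \<and>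
      (\<forall>u\<in>dual_pts. u \<subseteq> x \<longrightarrow> (\<exists>v\<in>dual_pts. v \<subseteq> y \<and> R u v))"
    proof cases
      case 1
      then show ?thesis using R_refl by blast
    next
      case 2
      have "x \<inter> G = y \<inter> G" using 2 colour unfolding I_def by blast
      moreover have "\<exists>v\<in>dual_pts. y \<subseteq> v \<and> R u v" if "u \<in> dual_pts" "x \<subseteq> u" for u
        using up_I[OF xy(2) _ that(1)] 2 that(2) unfolding I_def by blast
      moreover have "\<exists>v\<in>dual_pts. v \<subseteq> y \<and> R u v" if "u \<in> dual_pts" "u \<subseteq> x" for u
        using down_I[OF 2(2) that(1)] 2(1) that(2) unfolding I_def by blast
      moreover have "R y x" using 2 unfolding R_def by blast
      ultimately show ?thesis by simp
    next
      case 3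
      have "\<exists>v\<in>dual_pts. y \<subseteq> v \<and> R u v" if u: "u \<in> dual_pts" "x \<subseteq> u" for u
      proof (cases "x = u")
        case True
        then show ?thesis using 3 xy by blast
      next
        case False
        then have "a \<subseteq> u" using M(3)[OF 3(1) u(1)] u(2) by blast
        then show ?thesis using up_I[OF xy(2) M(2)[OF 3(2)] u(1)] by blast
      qed
      moreover have "\<exists>v\<in>dual_pts. v \<subseteq> y \<and> R u v" if u: "u \<in> dual_pts" "u \<subseteq> x" for u
        using minimal_eq[OF _ u] 3(1) M(1) xy by blast
      moreover have "R y x" using 3 unfolding R_def by simp
      ultimately show ?thesis using 3(3) by simp
    qed
  qed
  note trivial = bisimulation_trivial[OF G(2) this]
  show "a = b" using trivial[OF ab(1,2)] a_I b_I unfolding R_def by blast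
  show "s = t" if "s \<in> M" "t \<in> M" "s \<inter> G = t \<inter> G" for s t
    using trivial[of s t] that M(1) minimal_pt unfolding R_def by blast
qed

text \<open>The degenerate collapse with \<open>a = b = x\<close>: the segment is one point, so only
  equally coloured teeth at \<open>x\<close> would be merged.\<close>

lemma inj_on_teeth_colour:
  assumes "m \<subset> x"
  shows "inj_on (\<lambda>t. t \<inter> G) {t \<in> minimals. imm_pred t x}"
proof (cases "x \<in> dual_pts")
  case True
  let ?M = "{t \<in> minimals. imm_pred t x}"
  have "s = t" if "s \<in> ?M" "t \<in> ?M" "s \<inter> G = t \<inter> G" for s t
  proof (rule no_collapse(2)[OF True True assms order_refl, of ?M])
    show "x \<subseteq> q" if "t \<in> ?M" "q \<in> dual_pts" "t \<subset> q" for t q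
      using imm_pred_above that by blast
    show "t \<subseteq> x" if "t \<in> ?M" for t
      using that imm_predD(3) by blast
  qed (use that in auto)
  then show ?thesis unfolding inj_on_def by blast
next
  case False
  then have "{t \<in> minimals. imm_pred t x} = {}" using imm_predD(2) by blast
  then show ?thesis by (simp only: inj_on_empty)
qed

lemma finite_teeth:
  assumes "m \<subset> x"
  shows "finite {t \<in> minimals. imm_pred t x}" "card {t \<in> minimals. imm_pred t x} \<le> 2 ^ card G"
proof -
  let ?M = "{t \<in> minimals. imm_pred t x}"
  have sub: "(\<lambda>t. t \<inter> G) ` ?M \<subseteq> Pow G" by blast
  show "finite ?M"
    using inj_on_finite[OF inj_on_teeth_colour[OF assms] sub] G(1) by simp
  show "card ?M \<le> 2 ^ card G"
    using card_inj_on_le[OF inj_on_teeth_colour[OF assms] sub] G(1) by (simp add: card_Pow)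
qed

section \<open>Absence of down limits and the order type of the spine\<close>

lemma no_imm_succ_Inter:
  assumes x: "x \<in> up_set m - {r}" and no: "\<not> (\<exists>y. imm_pred x y)"
  shows "\<Inter>{c \<in> dual_pts. x \<subset> c} = x" "{c \<in> dual_pts. x \<subset> c} \<noteq> {}"
    "\<And>c d. c \<in> {c \<in> dual_pts. x \<subset> c} \<Longrightarrow> d \<in> {c \<in> dual_pts. x \<subset> c} \<Longrightarrow> c \<subseteq> d \<or> d \<subseteq> c"
proof -
  define Q where "Q = {c \<in> dual_pts. x \<subset> c}"
  have pt: "x \<in> dual_pts" and "m \<subseteq> x" and "x \<noteq> r" using x unfolding up_set_def by auto
  have "r \<in> Q" using \<open>x \<noteq> r\<close> le_r[OF pt] r_pt unfolding Q_def by blast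
  then have ne: "Q \<noteq> {}" by blast
  have lin: "c \<subseteq> d \<or> d \<subseteq> c" if "c \<in> Q" "d \<in> Q" for c d
    using upper_chain[OF pt, of c d] that unfolding Q_def by auto
  have "Q \<subseteq> dual_pts" unfolding Q_def by blast
  then have "\<Inter>Q \<in> dual_pts" using dual_pts_Inter_chain[OF ne _ lin] by blast
  \<comment> \<open>The infimum of the points strictly above \<open>x\<close> would be an immediate
    successor if it differed from \<open>x\<close>.\<close>
  moreover have "\<not> w \<subset> \<Inter>Q" if "w \<in> dual_pts" "x \<subset> w" for w
    using that unfolding Q_def by blast
  ultimately have "x \<subset> \<Inter>Q \<Longrightarrow> imm_pred x (\<Inter>Q)" using pt unfolding imm_pred_def by simp
  then have "\<not> x \<subset> \<Inter>Q" using no by blast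
  moreover have "x \<subseteq> \<Inter>Q" unfolding Q_def by blast
  ultimately have "\<Inter>Q = x" by blast
  then show "\<Inter>{c \<in> dual_pts. x \<subset> c} = x" "{c \<in> dual_pts. x \<subset> c} \<noteq> {}"
    "\<And>c d. c \<in> {c \<in> dual_pts. x \<subset> c} \<Longrightarrow> d \<in> {c \<in> dual_pts. x \<subset> c} \<Longrightarrow> c \<subseteq> d \<or> d \<subseteq> c"
    using ne lin unfolding Q_def by auto
qed

text \<open>A cluster point of points below ever smaller spine points lies below all of these, hence
  is \<open>m\<close>. So wrongly coloured points cannot persist, and some spine point has a downset
  of a single colour.\<close>

lemma m_has_imm_succ:
  assumes "m \<noteq> r"
  shows "\<exists>y. imm_pred m y"
proof (rule ccontr)
  assume no: "\<not> ?thesis"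
  define Q where "Q = {c \<in> dual_pts. m \<subset> c}"
  have "m \<in> up_set m - {r}" using assms m_pt unfolding up_set_def by blast
  note Q = no_imm_succ_Inter[OF this no, folded Q_def]
  define S where "S = (\<lambda>w. {t \<in> dual_pts. t \<subseteq> w \<and> t \<inter> G \<noteq> m \<inter> G})"
  have "\<exists>w\<in>Q. S w = {}"
  proof (rule ccontr)
    assume ne: "\<not> ?thesis"
    have "\<exists>P\<in>dual_pts. \<forall>T\<in>S ` Q. \<forall>H. finite H \<longrightarrow> (\<exists>t\<in>T. t \<inter> H = P \<inter> H)"
    proof (rule dual_pts_cluster_point)
      show "S ` Q \<noteq> {}" using Q(2) by blast
      show "T \<noteq> {} \<and> T \<subseteq> dual_pts" if "T \<in> S ` Q" for T
        using that ne unfolding S_def by blast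
      show "T \<subseteq> T' \<or> T' \<subseteq> T" if TT: "T \<in> S ` Q" "T' \<in> S ` Q" for T T'
      proof -
        obtain c d where cd: "c \<in> Q" "d \<in> Q" "T = S c" "T' = S d" using TT by blast
        then show ?thesis using Q(3)[OF cd(1,2)] unfolding S_def by blast
      qed
    qed
    then obtain P where P: "P \<in> dual_pts" and near: "\<And>w H. w \<in> Q \<Longrightarrow> finite H \<Longrightarrow> \<exists>t\<in>S w. t \<inter> H = P \<inter> H"
      by auto
    have "P \<subseteq> \<Inter>Q"
    proof (intro subsetI InterI)
      fix a w assume "a \<in> P" "w \<in> Q"
      then obtain t where "t \<in> S w" "a \<in> t" using near[of w "{a}"] by auto
      then show "a \<in> w" unfolding S_def by blast
    qed
    then have "P = m" using Q(1) minimal_eq[OF m_min P] by simp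
    obtain w where "w \<in> Q" using Q(2) by blast
    then show False using near[OF _ G(1)] \<open>P = m\<close> unfolding S_def by blast
  qed
  then obtain w where "w \<in> Q" "S w = {}" by blast
  then have w: "w \<in> dual_pts" "m \<subset> w"
    and colour: "t \<in> dual_pts \<Longrightarrow> t \<subseteq> w \<Longrightarrow> t \<inter> G = m \<inter> G" for t
    unfolding Q_def S_def by auto
  \<comment> \<open>The merged class is downward closed, so downward steps stay inside it; an upward
    step stays inside or reaches a point above \<open>w\<close>, which is above the whole
    class.\<close>
  define R where "R = (\<lambda>c d :: 'a set. c = d \<or> c \<subseteq> w \<and> d \<subseteq> w)"
  have "bisimulation G R"
    unfolding bisimulation_def
  proof (intro ballI impI)
    fix x y assume xy: "x \<in> dual_pts" "y \<in> dual_pts" "R x y"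
    show "R y x \<and> x \<inter> G = y \<inter> G \<and>
      (\<forall>u\<in>dual_pts. x \<subseteq> u \<longrightarrow> (\<exists>v\<in>dual_pts. y \<subseteq> v \<and> R u v)) \<and>
      (\<forall>u\<in>dual_pts. u \<subseteq> x \<longrightarrow> (\<exists>v\<in>dual_pts. v \<subseteq> y \<and> R u v))"
    proof (cases "x = y")
      case True
      then show ?thesis unfolding R_def by blast
    next
      case False
      then have le: "x \<subseteq> w" "y \<subseteq> w" using xy(3) unfolding R_def by blast+
      have "x \<inter> G = y \<inter> G" using colour xy(1,2) le by blast
      moreover have "\<exists>v\<in>dual_pts. y \<subseteq> v \<and> R u v" if u: "u \<in> dual_pts" "x \<subseteq> u" for u
      proof -
        have "u \<subseteq> w \<or> w \<subseteq> u" using upper_chain[OF xy(1) u w(1) le(1)] .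
        then show ?thesis using u(1) w(1) le(2) unfolding R_def by blast
      qed
      moreover have "\<exists>v\<in>dual_pts. v \<subseteq> y \<and> R u v" if "u \<in> dual_pts" "u \<subseteq> x" for u
        using that le xy(2) unfolding R_def by blast
      moreover have "R y x" using le unfolding R_def by blast
      ultimately show ?thesis by simp
    qed
  qed
  then have "m = w"
    using bisimulation_trivial[OF G(2) _ m_pt w(1)] w(2) unfolding R_def by blast
  then show False using w(2) by blast
qed

lemma no_down_limit: "\<not> down_limit m r x"
proof
  assume "down_limit m r x"
  then have x: "x \<in> up_set m - {r}" and no: "\<not> (\<exists>y. imm_pred x y)"
    unfolding down_limit_def by auto
  then have pt: "x \<in> dual_pts" and mx: "m \<subset> x"
    using m_has_imm_succ unfolding up_set_def by blast+
  define Q where "Q = {c \<in> dual_pts. x \<subset> c}"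
  note Q = no_imm_succ_Inter[OF x no, folded Q_def]
  \<comment> \<open>The bad points: their colour is realised by no tooth at \<open>x\<close>. A
    limit of bad points would itself be a tooth at \<open>x\<close> sharing its colour with a bad
    point.\<close>
  define S where "S = (\<lambda>w. {t \<in> minimals. t \<subseteq> w \<and> \<not> t \<subseteq> x \<and>
      \<not> (\<exists>p\<in>minimals. imm_pred p x \<and> p \<inter> G = t \<inter> G)})"
  have "\<exists>w\<in>Q. S w = {}"
  proof (rule ccontr)
    assume ne: "\<not> ?thesis"
    have "\<exists>P\<in>minimals. imm_pred P x \<and> (\<forall>T\<in>S ` Q. \<forall>H. finite H \<longrightarrow> (\<exists>t\<in>T. t \<inter> H = P \<inter> H))"
    proof (rule limit_of_teeth[OF pt mx])
      show "S ` Q \<noteq> {}" using Q(2) by blast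
      have "S w \<subseteq> minimals" for w unfolding S_def by blast
      then show "T \<noteq> {} \<and> T \<subseteq> minimals" if "T \<in> S ` Q" for T
        using that ne by auto
      show "T \<subseteq> T' \<or> T' \<subseteq> T" if TT: "T \<in> S ` Q" "T' \<in> S ` Q" for T T'
      proof -
        obtain c d where cd: "c \<in> Q" "d \<in> Q" "T = S c" "T' = S d" using TT by blast
        then show ?thesis using Q(3)[OF cd(1,2)] unfolding S_def by blast
      qed
      show "\<exists>T\<in>S ` Q. \<forall>t\<in>T. a \<notin> t" if "a \<notin> x" for a
      proof -
        have "a \<notin> \<Inter>Q" using that Q(1) by simp
        then obtain w where "w \<in> Q" "a \<notin> w" by blast
        moreover from this have "\<forall>t\<in>S w. a \<notin> t" unfolding S_def by blast
        ultimately show ?thesis by blast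
      qed
      show "\<exists>T\<in>S ` Q. \<forall>t\<in>T. \<forall>g\<in>dual_pts. m \<subset> g \<longrightarrow> t \<subseteq> g \<longrightarrow> f \<in> g" if "f \<in> x" for f
      proof -
        obtain w where w: "w \<in> Q" using Q(2) by blast
        have "f \<in> g" if "t \<in> S w" "g \<in> dual_pts" "m \<subset> g" "t \<subseteq> g" for t g
        proof -
          have "x \<subseteq> g" using spine_chain[OF pt that(2)] that mx unfolding S_def by blast
          then show ?thesis using \<open>f \<in> x\<close> by blast
        qed
        then show ?thesis by (intro bexI[OF _ imageI[OF w]]) simp
      qed
    qed
    then obtain P where P: "P \<in> minimals" "imm_pred P x"
      and near: "\<And>w H. w \<in> Q \<Longrightarrow> finite H \<Longrightarrow> \<exists>t\<in>S w. t \<inter> H = P \<inter> H"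
      by auto
    obtain w where "w \<in> Q" using Q(2) by blast
    then obtain t where "t \<in> S w" "t \<inter> G = P \<inter> G" using near G(1) by blast
    then show False using P unfolding S_def by blast
  qed
  then obtain w1 where w1: "w1 \<in> Q" "S w1 = {}" by blast
  \<comment> \<open>Only finitely many generators are missing from \<open>x\<close>, so one member
    of \<open>Q\<close> avoids them all, and the spine from \<open>x\<close> up to it has the colour
    of \<open>x\<close>.\<close>
  have "(G - x) \<inter> \<Inter>Q = {}" using Q(1) by auto
  then obtain w2 where w2: "w2 \<in> Q" "(G - x) \<inter> w2 = {}"
    using chain_avoids[OF finite_Diff[OF G(1)] Q(2,3)] by blast
  obtain w where w: "w \<in> Q" "w \<subseteq> w1" "w \<subseteq> w2"
    using Q(3)[OF w1(1) w2(1)] w1(1) w2(1) by blast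
  then have wpt: "w \<in> dual_pts" "x \<subset> w" unfolding Q_def by auto
  \<comment> \<open>This contains the teeth at \<open>x\<close> as well as those between
    \<open>x\<close> and \<open>w\<close>, since the former supply the partners below
    \<open>x\<close> for the latter.\<close>
  define M where "M = {p \<in> minimals. p \<subseteq> w \<and> (\<forall>q\<in>dual_pts. p \<subset> q \<longrightarrow> x \<subseteq> q)}"
  have "x = w"
  proof (rule no_collapse(1)[OF pt wpt(1) mx, of M])
    show "x \<subseteq> w" using wpt by blast
    show "M \<subseteq> minimals" unfolding M_def by blast
    show "t \<subseteq> w" if "t \<in> M" for t using that unfolding M_def by blast
    show "x \<subseteq> q" if "t \<in> M" "q \<in> dual_pts" "t \<subset> q" for t q using that unfolding M_def by blast
    show "c \<inter> G = x \<inter> G" if "x \<subseteq> c" "c \<subseteq> w" for c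
      using that w2(2) w(3) by blast
    show "e \<in> M \<and> (\<exists>p\<in>M. p \<subseteq> x \<and> p \<inter> G = e \<inter> G)" if e: "e \<in> minimals" "e \<subseteq> w" "\<not> e \<subseteq> x" for e
    proof
      have "x \<subseteq> q" if q: "q \<in> dual_pts" "e \<subset> q" for q
        using spine_chain[OF q(1) pt] above_minimal[OF e(1) q] mx e(3) q(2) by blast
      then show "e \<in> M" using e unfolding M_def by blast
      have "e \<notin> S w1" using w1(2) by simp
      then obtain p where p: "p \<in> minimals" "imm_pred p x" "p \<inter> G = e \<inter> G"
        using e w(2) unfolding S_def by blast
      have "p \<in> M"
        using p imm_pred_above[OF p(2)] imm_predD(3)[OF p(2)] wpt(2) unfolding M_def by blast
      then show "\<exists>p\<in>M. p \<subseteq> x \<and> p \<inter> G = e \<inter> G" using p imm_predD(3)[OF p(2)] by blast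
    qed
  qed
  then show False using wpt by blast
qed

text \<open>Every point is on the spine or hangs from it, and each spine point carries finitely many
  teeth; a finite spine would make the dual finite.\<close>

lemma up_set_infinite:
  assumes "infinite (UNIV :: 'a set)"
  shows "infinite (up_set m)"
proof
  assume fin: "finite (up_set m)"
  have "dual_pts \<subseteq> up_set m \<union> (\<Union>x\<in>{x \<in> up_set m. m \<subset> x}. {t \<in> minimals. imm_pred t x})"
  proof
    fix y :: "'a set" assume y: "y \<in> dual_pts"
    show "y \<in> up_set m \<union> (\<Union>x\<in>{x \<in> up_set m. m \<subset> x}. {t \<in> minimals. imm_pred t x})"
    proof (cases "m \<subseteq> y")
      case True
      then show ?thesis using y unfolding up_set_def by blast
    next
      case False
      then have "y \<in> minimals" "y \<noteq> m" using spine_or_minimal[OF y] by blast+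
      then obtain z where "imm_pred y z" "m \<subset> z" using hanging by blast
      then show ?thesis using \<open>y \<in> minimals\<close> imm_predD(2) unfolding up_set_def by blast
    qed
  qed
  moreover have "finite (up_set m \<union> (\<Union>x\<in>{x \<in> up_set m. m \<subset> x}. {t \<in> minimals. imm_pred t x}))"
    using fin finite_teeth(1) by auto
  ultimately show False using infinite_dual_pts[OF assms] finite_subset by blast
qed

text \<open>The infimum of a nonempty set without least element would be a point other than
  \<open>r\<close>, and its immediate successor would still be a lower bound.\<close>

lemma up_set_well_order:
  "well_order_on (up_set m) {(x, y). x \<in> up_set m \<and> y \<in> up_set m \<and> x \<subseteq> y}"
    (is "well_order_on _ ?le")
proof -
  have lin: "x \<subseteq> y \<or> y \<subseteq> x" if "x \<in> up_set m" "y \<in> up_set m" for x y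
    using spine_chain that unfolding up_set_def by blast
  have least: "\<exists>q\<in>Q. \<forall>q'\<in>Q. q \<subseteq> q'" if Q: "Q \<subseteq> up_set m" "Q \<noteq> {}" for Q
  proof (rule ccontr)
    assume no: "\<not> ?thesis"
    have pts: "Q \<subseteq> dual_pts" using Q unfolding up_set_def by blast
    have y: "\<Inter>Q \<in> dual_pts" using dual_pts_Inter_chain[OF Q(2) pts] lin Q(1) by blast
    have "\<Inter>Q \<notin> Q" using no by blast
    then have less: "\<Inter>Q \<subset> q" if "q \<in> Q" for q using that by blast
    have "m \<subseteq> \<Inter>Q" using Q(1) unfolding up_set_def by blast
    moreover obtain q where "q \<in> Q" using Q(2) by blast
    then have "\<Inter>Q \<noteq> r" using less[of q] le_r[of q] pts by blast
    ultimately have "\<Inter>Q \<in> up_set m - {r}" using y unfolding up_set_def by simp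
    then obtain s where s: "imm_pred (\<Inter>Q) s" using no_down_limit unfolding down_limit_def by blast
    have "s \<subseteq> q" if "q \<in> Q" for q
      using imm_pred_above[OF s _ less[OF that]] that pts by blast
    then show False using imm_predD(3)[OF s] by blast
  qed
  have "linear_order_on (up_set m) ?le"
    using lin unfolding linear_order_on_def partial_order_on_def preorder_on_def
    by (auto simp: refl_on_def trans_def antisym_def total_on_def)
  moreover have "wf (?le - Id)"
  proof (rule wfI_min)
    fix x :: "'a set" and Q assume "x \<in> Q"
    show "\<exists>z\<in>Q. \<forall>y. (y, z) \<in> ?le - Id \<longrightarrow> y \<notin> Q"
    proof (cases "Q \<inter> up_set m = {}")
      case True
      then show ?thesis using \<open>x \<in> Q\<close> by blast
    next
      case False
      then obtain q where "q \<in> Q \<inter> up_set m" "\<forall>q'\<in>Q \<inter> up_set m. q \<subseteq> q'"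
        using least[of "Q \<inter> up_set m"] by blast
      then show ?thesis by blast
    qed
  qed
  ultimately show ?thesis unfolding well_order_on_def by blast
qed

section \<open>Immediate predecessors at successors and at up limits\<close>

lemma successor_imm_preds:
  assumes zx: "imm_pred z x" and mz: "m \<subset> z"
  shows "\<exists>!z. imm_pred z x \<and> m \<subset> z" "\<exists>!t. imm_pred t x \<and> \<not> m \<subset> t"
proof -
  show "\<exists>!z. imm_pred z x \<and> m \<subset> z"
  proof (rule ex1I)
    show "imm_pred z x \<and> m \<subset> z" using assms by blast
    show "z' = z" if "imm_pred z' x \<and> m \<subset> z'" for z'
      using spine_chain[of z z'] imm_predD[OF zx] imm_predD[of z' x] that mz by blast
  qed
  show "\<exists>!t. imm_pred t x \<and> \<not> m \<subset> t"
    using successor_tooth_exists[OF F1 F2 zx mz] successor_tooth_unique[OF F3 zx mz] by blast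
qed

text \<open>Since \<open>m\<close> belongs to \<open>up_set m\<close>, an up limit is not an
  immediate successor of \<open>m\<close>; hence spine points lie strictly between. Their union is a
  point, and it would be an immediate predecessor if it were smaller than \<open>x\<close>.\<close>

lemma up_limit_Union:
  assumes x: "up_limit m x"
  shows "\<Union>{c \<in> dual_pts. m \<subset> c \<and> c \<subset> x} = x" "{c \<in> dual_pts. m \<subset> c \<and> c \<subset> x} \<noteq> {}"
proof -
  define Q where "Q = {c \<in> dual_pts. m \<subset> c \<and> c \<subset> x}"
  have pt: "x \<in> dual_pts" and mx: "m \<subset> x" and no: "\<And>z. z \<in> up_set m \<Longrightarrow> \<not> imm_pred z x"
    using x unfolding up_limit_def by auto
  have "\<not> imm_pred m x" using no[of m] m_pt unfolding up_set_def by blast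
  then have ne: "Q \<noteq> {}" using pt mx m_pt unfolding imm_pred_def Q_def by blast
  have lin: "c \<subseteq> d \<or> d \<subseteq> c" if "c \<in> Q" "d \<in> Q" for c d
    using spine_chain[of c d] that unfolding Q_def by auto
  have "Q \<subseteq> dual_pts" unfolding Q_def by blast
  then have U: "\<Union>Q \<in> dual_pts" using dual_pts_Union_chain[OF ne _ lin] by blast
  have mU: "m \<subset> \<Union>Q" using ne unfolding Q_def by blast
  then have "\<not> imm_pred (\<Union>Q) x" using no[of "\<Union>Q"] U unfolding up_set_def by blast
  moreover have "\<not> w \<subset> x" if "w \<in> dual_pts" "\<Union>Q \<subset> w" for w
  proof
    assume "w \<subset> x"
    then have "w \<in> Q" using that mU unfolding Q_def by blast
    then show False using that(2) by blast
  qed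
  ultimately have "\<not> \<Union>Q \<subset> x" using U pt unfolding imm_pred_def by simp
  moreover have "\<Union>Q \<subseteq> x" unfolding Q_def by blast
  ultimately have "\<Union>Q = x" by blast
  then show "\<Union>{c \<in> dual_pts. m \<subset> c \<and> c \<subset> x} = x" "{c \<in> dual_pts. m \<subset> c \<and> c \<subset> x} \<noteq> {}"
    using ne unfolding Q_def by blast+
qed

text \<open>The predicate \<open>B\<close> prescribes which teeth are used. The trivial one gives
  some predecessor of \<open>x\<close>; a condition on the generators carries over to the limit and
  so gives a predecessor of a chosen kind.\<close>

lemma up_limit_of_teeth:
  assumes x: "up_limit m x"
    and B: "\<And>c. c \<in> dual_pts \<Longrightarrow> m \<subset> c \<Longrightarrow> c \<subset> x \<Longrightarrow> \<exists>t\<in>minimals. t \<subseteq> x \<and> \<not> t \<subseteq> c \<and> B t"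
  shows "\<exists>P\<in>minimals. imm_pred P x \<and> (\<forall>H. finite H \<longrightarrow> (\<exists>t. B t \<and> t \<inter> H = P \<inter> H))"
proof -
  have pt: "x \<in> dual_pts" and mx: "m \<subset> x" using x unfolding up_limit_def by auto
  define Q where "Q = {c \<in> dual_pts. m \<subset> c \<and> c \<subset> x}"
  note Q = up_limit_Union[OF x, folded Q_def]
  define S where "S = (\<lambda>c. {t \<in> minimals. t \<subseteq> x \<and> \<not> t \<subseteq> c \<and> B t})"
  have "\<exists>P\<in>minimals. imm_pred P x \<and> (\<forall>T\<in>S ` Q. \<forall>H. finite H \<longrightarrow> (\<exists>t\<in>T. t \<inter> H = P \<inter> H))"
  proof (rule limit_of_teeth[OF pt mx])
    show "S ` Q \<noteq> {}" using Q(2) by blast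
    have "S c \<subseteq> minimals" for c unfolding S_def by blast
    moreover have "S c \<noteq> {}" if "c \<in> Q" for c
      using B[of c] that unfolding S_def Q_def by blast
    ultimately show "T \<noteq> {} \<and> T \<subseteq> minimals" if "T \<in> S ` Q" for T
      using that by auto
    show "T \<subseteq> T' \<or> T' \<subseteq> T" if TT: "T \<in> S ` Q" "T' \<in> S ` Q" for T T'
    proof -
      obtain c d where cd: "c \<in> Q" "d \<in> Q" "T = S c" "T' = S d" using TT by blast
      then have "c \<subseteq> d \<or> d \<subseteq> c" using spine_chain[of c d] unfolding Q_def by blast
      then show ?thesis unfolding cd S_def by blast
    qed
    show "\<exists>T\<in>S ` Q. \<forall>t\<in>T. a \<notin> t" if "a \<notin> x" for a
    proof -
      obtain c where c: "c \<in> Q" using Q(2) by blast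
      have "\<forall>t\<in>S c. a \<notin> t" using that unfolding S_def by blast
      then show ?thesis by (rule bexI[OF _ imageI[OF c]])
    qed
    show "\<exists>T\<in>S ` Q. \<forall>t\<in>T. \<forall>g\<in>dual_pts. m \<subset> g \<longrightarrow> t \<subseteq> g \<longrightarrow> f \<in> g" if "f \<in> x" for f
    proof -
      have "f \<in> \<Union>Q" using that Q(1) by simp
      then obtain c where c: "c \<in> Q" "f \<in> c" by blast
      have "f \<in> g" if "t \<in> S c" "g \<in> dual_pts" "m \<subset> g" "t \<subseteq> g" for t g
      proof -
        have "c \<subseteq> g" using spine_chain[of c g] that c(1) unfolding S_def Q_def by blast
        then show ?thesis using c(2) by blast
      qed
      then show ?thesis by (intro bexI[OF _ imageI[OF c(1)]]) simp
    qed
  qed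
  then obtain P where P: "P \<in> minimals" "imm_pred P x"
    and near: "\<And>c H. c \<in> Q \<Longrightarrow> finite H \<Longrightarrow> \<exists>t\<in>S c. t \<inter> H = P \<inter> H"
    by auto
  obtain c where "c \<in> Q" using Q(2) by blast
  then have "\<exists>t. B t \<and> t \<inter> H = P \<inter> H" if "finite H" for H
    using near[OF _ that] unfolding S_def by blast
  then show ?thesis using P by blast
qed

text \<open>Supplies teeth cofinally below \<open>x\<close>: \<open>c\<close> has an immediate
  successor still below \<open>x\<close>, and the tooth there is not below \<open>c\<close>.\<close>

lemma successor_below_up_limit:
  assumes x: "up_limit m x" and c: "c \<in> dual_pts" "m \<subset> c" "c \<subset> x"
  obtains d t where "imm_pred c d" "d \<subset> x" "t \<in> minimals" "imm_pred t d" "\<not> t \<subseteq> c"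
proof -
  have pt: "x \<in> dual_pts" and no: "\<And>z. z \<in> up_set m \<Longrightarrow> \<not> imm_pred z x"
    using x unfolding up_limit_def by auto
  have c_up: "c \<in> up_set m" using c unfolding up_set_def by blast
  moreover have "c \<noteq> r" using c(3) le_r[OF pt] by blast
  ultimately obtain d where d: "imm_pred c d"
    using no_down_limit unfolding down_limit_def by blast
  have "d \<subset> x" using imm_pred_above[OF d pt c(3)] no[OF c_up] d by blast
  moreover obtain t where t: "imm_pred t d" "\<not> m \<subset> t"
    using successor_tooth_exists[OF F1 F2 d c(2)] by blast
  moreover have "t \<in> minimals" using spine_or_minimal imm_predD(1)[OF t(1)] t(2) by blast
  moreover have "\<not> t \<subseteq> c"
    using imm_predD(4)[OF t(1) c(1)] imm_predD(3)[OF d] t(2) c(2) by blast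
  ultimately show thesis using that d by blast
qed

lemma up_limit_imm_preds:
  assumes x: "up_limit m x"
  shows "finite (imm_preds x)" "2 \<le> card (imm_preds x)" "card (imm_preds x) \<le> 2 ^ card G"
proof -
  have pt: "x \<in> dual_pts" and mx: "m \<subset> x" and no: "\<And>z. z \<in> up_set m \<Longrightarrow> \<not> imm_pred z x"
    using x unfolding up_limit_def by auto
  have imm: "imm_preds x = {t \<in> minimals. imm_pred t x}"
  proof -
    have "z \<in> minimals" if "imm_pred z x" for z
      using no[of z] that spine_or_minimal[of z] imm_predD(1)[OF that] unfolding up_set_def by blast
    then show ?thesis unfolding imm_preds_def by blast
  qed
  show fin: "finite (imm_preds x)" and "card (imm_preds x) \<le> 2 ^ card G"
    using finite_teeth[OF mx] unfolding imm by auto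
  define Q where "Q = {c \<in> dual_pts. m \<subset> c \<and> c \<subset> x}"
  note Q = up_limit_Union[OF x, folded Q_def]
  have Q_lin: "c \<subseteq> d \<or> d \<subseteq> c" if "c \<in> Q" "d \<in> Q" for c d
    using spine_chain[of c d] that unfolding Q_def by blast
  \<comment> \<open>The conjunct \<open>True\<close> is the trivial instance of the predicate
    \<open>B\<close>.\<close>
  have tooth: "\<exists>t\<in>minimals. t \<subseteq> x \<and> \<not> t \<subseteq> c \<and> True" if c: "c \<in> dual_pts" "m \<subset> c" "c \<subset> x" for c
  proof -
    obtain d t where "imm_pred c d" "d \<subset> x" "t \<in> minimals" "imm_pred t d" "\<not> t \<subseteq> c"
      using successor_below_up_limit[OF x c] by blast
    then show ?thesis using imm_predD(3)[of t d] by blast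
  qed
  obtain p where p: "p \<in> imm_preds x"
    using up_limit_of_teeth[OF x tooth] unfolding imm by blast
  have "\<exists>p'\<in>imm_preds x. p' \<noteq> p"
  proof (rule ccontr)
    assume "\<not> ?thesis"
    then have only: "p' = p" if "p' \<in> minimals" "imm_pred p' x" for p'
      using that unfolding imm by blast
    \<comment> \<open>Otherwise teeth not coloured like \<open>p\<close> would occur arbitrarily
      high below \<open>x\<close>, and their limit would be a second predecessor of
      \<open>x\<close>.\<close>
    have "\<exists>c1\<in>Q. \<forall>t\<in>minimals. t \<subseteq> x \<longrightarrow> \<not> t \<subseteq> c1 \<longrightarrow> t \<inter> G = p \<inter> G"
    proof (rule ccontr)
      assume none: "\<not> ?thesis"
      have "\<exists>t\<in>minimals. t \<subseteq> x \<and> \<not> t \<subseteq> c \<and> t \<inter> G \<noteq> p \<inter> G"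
        if "c \<in> dual_pts" "m \<subset> c" "c \<subset> x" for c
      proof -
        have "c \<in> Q" using that unfolding Q_def by blast
        then show ?thesis using none by meson
      qed
      then have "\<exists>P\<in>minimals. imm_pred P x \<and> (\<forall>H. finite H \<longrightarrow> (\<exists>t. t \<inter> G \<noteq> p \<inter> G \<and> t \<inter> H = P \<inter> H))"
        by (rule up_limit_of_teeth[OF x])
      then show False using only G(1) by blast
    qed
    then obtain c1 where c1: "c1 \<in> Q"
      and c1_colour: "\<And>t. t \<in> minimals \<Longrightarrow> t \<subseteq> x \<Longrightarrow> \<not> t \<subseteq> c1 \<Longrightarrow> t \<inter> G = p \<inter> G"
      by blast
    have "x \<inter> G \<subseteq> \<Union>Q" using Q(1) by blast
    then obtain c2 where c2: "c2 \<in> Q" "x \<inter> G \<subseteq> c2"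
      using chain_contains[OF finite_Int[of x G] Q(2) Q_lin] G(1) by blast
    obtain c where c: "c \<in> Q" "c1 \<subseteq> c" "c2 \<subseteq> c"
      using Q_lin[OF c1 c2(1)] c1 c2(1) by blast
    then have c_pt: "c \<in> dual_pts" "m \<subset> c" "c \<subset> x" unfolding Q_def by auto
    \<comment> \<open>The collapsed segment starts at the successor \<open>a\<close> of
      \<open>c\<close>, because its tooth \<open>t\<close> is the partner below \<open>a\<close>
      that every higher tooth, \<open>p\<close> included, needs.\<close>
    obtain a t where a: "imm_pred c a" "a \<subset> x" and t: "t \<in> minimals" "imm_pred t a" "\<not> t \<subseteq> c"
      using successor_below_up_limit[OF x c_pt] by blast
    note ca = imm_predD(3)[OF a(1)] and ta = imm_predD(3)[OF t(2)]
    define M where "M = {t \<in> minimals. t \<subseteq> x \<and> \<not> t \<subseteq> c}"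
    have M_colour: "s \<inter> G = p \<inter> G" if "s \<in> M" for s
      using that c1_colour[of s] c(2) unfolding M_def by blast
    have "t \<in> M" using t ta a(2) unfolding M_def by blast
    have "a = x"
    proof (rule no_collapse(1)[OF imm_predD(2)[OF a(1)] pt, of M])
      show "m \<subset> a" using c_pt(2) ca by blast
      show "a \<subseteq> x" using a(2) by blast
      show "M \<subseteq> minimals" unfolding M_def by blast
      show "s \<subseteq> x" if "s \<in> M" for s using that unfolding M_def by blast
      show "d \<inter> G = a \<inter> G" if "a \<subseteq> d" "d \<subseteq> x" for d
        using that c2(2) c(3) ca by blast
      show "a \<subseteq> q" if "s \<in> M" "q \<in> dual_pts" "s \<subset> q" for s q
      proof -
        have "m \<subset> q" using that above_minimal[of s q] unfolding M_def by blast
        then have "c \<subset> q" using spine_chain[OF c_pt(1) that(2)] c_pt(2) that unfolding M_def by blast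
        then show ?thesis using imm_pred_above[OF a(1) that(2)] by blast
      qed
      show "e \<in> M \<and> (\<exists>p\<in>M. p \<subseteq> a \<and> p \<inter> G = e \<inter> G)" if e: "e \<in> minimals" "e \<subseteq> x" "\<not> e \<subseteq> a" for e
      proof -
        have "e \<in> M" using e ca unfolding M_def by blast
        then show ?thesis using M_colour \<open>t \<in> M\<close> ta by (metis psubset_imp_subset)
      qed
    qed
    then show False using a(2) by blast
  qed
  then obtain p' where "p' \<in> imm_preds x" "p' \<noteq> p" by blast
  then have "card {p, p'} \<le> card (imm_preds x)"
    using p fin by (intro card_mono) auto
  then show "2 \<le> card (imm_preds x)" using \<open>p' \<noteq> p\<close> by simp
qed

end

theorem theorem3p19:
  fixes n :: nat
    and imp coimp :: "'a::{distrib_lattice,bounded_lattice} \<Rightarrow> 'a \<Rightarrow> 'a"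
    and r m :: "'a set"
  assumes "0 < n"
    and "bi_heyting imp coimp"
    and "infinite (UNIV :: 'a set)"
    and "n_generated n imp coimp"
    and "bh_SI imp coimp"
    and "validates_LFC imp coimp"
    and "r \<in> dual_pts" and "\<forall>x\<in>dual_pts. x \<subseteq> r"
    and "m \<in> minimals"
    and "dual_pts = {x \<in> dual_pts. m \<subset> x} \<union> minimals"
    and "\<forall>y\<in>minimals. y \<noteq> m \<longrightarrow> (\<exists>!z. imm_pred y z \<and> m \<subset> z)"
  shows "(\<forall>x. up_limit m x \<longrightarrow>
             finite (imm_preds x) \<and> 2 \<le> card (imm_preds x) \<and> card (imm_preds x) \<le> 2 ^ n)
       \<and> (\<forall>x. \<not> down_limit m r x)
       \<and> (infinite (up_set m) \<and>
          well_order_on (up_set m) {(x, y). x \<in> up_set m \<and> y \<in> up_set m \<and> x \<subseteq> y})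
       \<and> (\<forall>x. imm_pred m x \<longrightarrow> finite (imm_preds x) \<and> card (imm_preds x) \<le> 2)
       \<and> (\<forall>x\<in>dual_pts. m \<subset> x \<and> \<not> imm_pred m x \<and> \<not> up_limit m x \<longrightarrow>
            (\<exists>!z. imm_pred z x \<and> m \<subset> z) \<and> (\<exists>!z. imm_pred z x \<and> \<not> m \<subset> z))"
proof -
  obtain G where gen: "finite G" "card G \<le> n" "bh_generated imp coimp G = UNIV"
    using assms(4) unfolding n_generated_def by blast
  interpret LFC_comb imp coimp m r G
  proof
    show "m \<subset> x \<or> x \<in> minimals" if "x \<in> dual_pts" for x
      using that assms(10) by blast
    show "\<exists>z. imm_pred t z \<and> m \<subset> z" if "t \<in> minimals" "t \<noteq> m" for t
      using that assms(11) by blast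
  qed (use assms gen in \<open>auto simp: validates_LFC_def\<close>)
  show ?thesis
  proof (intro conjI allI impI ballI; (elim conjE)?)
    fix x assume "up_limit m x"
    note limit = up_limit_imm_preds[OF this]
    show "finite (imm_preds x)" "2 \<le> card (imm_preds x)" using limit by blast+
    have "(2::nat) ^ card G \<le> 2 ^ n" using gen(2) by (simp add: power_increasing)
    then show "card (imm_preds x) \<le> 2 ^ n" using limit(3) by linarith
  next
    fix x assume x: "imm_pred m x"
    show "finite (imm_preds x)" "card (imm_preds x) \<le> 2"
      using card_imm_preds_bottom[OF F3 x] by blast+
  next
    fix x assume x: "x \<in> dual_pts" "m \<subset> x" "\<not> imm_pred m x" "\<not> up_limit m x"
    then obtain z where z: "z \<in> up_set m" "imm_pred z x" unfolding up_limit_def by blast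
    then have "m \<subset> z" using x(3) unfolding up_set_def by blast
    note preds = successor_imm_preds[OF z(2) this]
    show "\<exists>!z. imm_pred z x \<and> m \<subset> z" by (rule preds(1))
    show "\<exists>!z. imm_pred z x \<and> \<not> m \<subset> z" by (rule preds(2))
  qed (rule no_down_limit up_set_infinite[OF assms(3)] up_set_well_order)+
qed

end
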